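(* Let $k\ge1$ and consider the half-space model $\mathbb C\mathbf H^k=\mathbb C^{k-1}\oplus\mathbb R\times\mathbb R_+$ of the complex hyperbolic space, with the totally geodesic submanifold $\mathbb R\mathbf H^k=\{(v,0,t): v\in\mathbb R^{k-1},\,t>0\}$. Let $r(v,z,t)$ denote the distance of the point $(v,z,t)$ from $\mathbb R\mathbf H^k$. Then $$\cosh^2(r(v,z,t))=\frac1{t^2}\left(\left(t+\tfrac12\|\mathrm{Im}\,v\|^2\right)^2+\left\|z-\tfrac12[\mathrm{Re}\,v,\mathbf i\,\mathrm{Im}\,v]\right\|^2\right)$$ for all $(v,z,t)\in\mathbb C\mathbf H^k$. In particular, the tubes about $\mathbb R\mathbf H^k$ in $\mathbb C\mathbf H^k$ are the regular level sets of the function on the right-hand side, which is an isoparametric function of the form of a quartic polynomial in $(v,z,t)$ divided by $t^2$.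
   Context: $\mathbb C\mathbf H^k$ is modelled as the Damek--Ricci space with $\mathfrak v=\mathbb C^{k-1}$ (with Euclidean inner product $\langle v_1,v_2\rangle=\mathrm{Re}\sum_j v_1^j\overline{v_2^j}$), $\mathfrak z=\mathbb R$, and $J_zv=z\,\mathbf i\,v$, $\mathbf i$ being the imaginary unit. The bracket $[\cdot,\cdot]\colon\mathfrak v\times\mathfrak v\to\mathfrak z$ is defined by $\langle[v_1,v_2],z\rangle=\langle J_zv_1,v_2\rangle$, i.e. $[v_1,v_2]=\langle\mathbf i v_1,v_2\rangle$. The half-space model is $\{(v,z,t): v\in\mathfrak v, z\in\mathfrak z, t>0\}$ with the Riemannian metric $$\langle(v_1,z_1,t_1),(v_2,z_2,t_2)\rangle_{(\bar v,\bar z,\bar t)}=\tfrac1{\bar t}\langle v_1,v_2\rangle+\tfrac1{\bar t^2}\left\langle z_1+\tfrac12[v_1,\bar v],z_2+\tfrac12[v_2,\bar v]\right\rangle+\tfrac{t_1t_2}{\bar t^2}.$$ $\mathrm{Re}\,v,\mathrm{Im}\,v\in\mathbb R^{k-1}$ are the componentwise real and imaginary parts of $v$. A smooth function $F$ on a Riemannian manifold is isoparametric if $\Delta F=a\circ F$ and $\|\nabla F\|^2=b\circ F$ for a continuous $a$ and a $\mathcal C^2$ function $b$ on $\mathrm{im}\,F$. A tube about a submanifold is the set of points at a fixed positive distance from it. *)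

theory Defs
  imports "HOL-Analysis.Analysis"
begin

section \<open>Riemannian geometry on an open subset of a Euclidean space\<close>

text \<open>
  An open set \<open>U\<close> carries a metric \<open>g\<close>, where \<open>g p X Y\<close> is the inner product of the tangent
  vectors \<open>X\<close>, \<open>Y\<close> at \<open>p\<close>; all tangent spaces are identified with the ambient space.
\<close>

type_synonym 'a metric_field = "'a \<Rightarrow> 'a \<Rightarrow> 'a \<Rightarrow> real"

definition speed :: "'a::euclidean_space metric_field \<Rightarrow> (real \<Rightarrow> 'a) \<Rightarrow> real \<Rightarrow> real" where
  "speed g \<gamma> s = sqrt (g (\<gamma> s) (vector_derivative \<gamma> (at s)) (vector_derivative \<gamma> (at s)))"

text \<open>
  \<open>valid_path\<close> (piecewise C1) puts no bound on the derivative near the finitely many break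
  points, and \<open>integral\<close> is 0 on non-integrable functions; hence curves whose speed is not
  integrable (those of infinite length) have to be excluded explicitly.
\<close>

definition riem_dist :: "'a::euclidean_space set \<Rightarrow> 'a metric_field \<Rightarrow> 'a \<Rightarrow> 'a \<Rightarrow> real" where
  "riem_dist U g p q =
     Inf {integral {0..1} (speed g \<gamma>) |\<gamma>.
            valid_path \<gamma> \<and> path_image \<gamma> \<subseteq> U \<and> pathstart \<gamma> = p \<and> pathfinish \<gamma> = q \<and>
            speed g \<gamma> integrable_on {0..1}}"

definition riem_infdist :: "'a::euclidean_space set \<Rightarrow> 'a metric_field \<Rightarrow> 'a \<Rightarrow> 'a set \<Rightarrow> real" where
  "riem_infdist U g p N = (INF q\<in>N. riem_dist U g p q)"

definition tubes :: "'a::euclidean_space set \<Rightarrow> 'a metric_field \<Rightarrow> 'a set \<Rightarrow> 'a set set" where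
  "tubes U g N = {{p \<in> U. riem_infdist U g p N = \<rho>} |\<rho>. \<rho> > 0}"

definition riem_grad :: "'a::euclidean_space metric_field \<Rightarrow> ('a \<Rightarrow> real) \<Rightarrow> 'a \<Rightarrow> 'a" where
  "riem_grad g f p = (THE G. \<forall>W. g p G W = frechet_derivative f (at p) W)"

text \<open>Levi-Civita connection: \<open>christoffel g p X Y\<close> is the covariant derivative along \<open>X\<close> at \<open>p\<close>
  of the constant vector field \<open>Y\<close>, given by the Koszul formula.\<close>

definition christoffel :: "'a::euclidean_space metric_field \<Rightarrow> 'a \<Rightarrow> 'a \<Rightarrow> 'a \<Rightarrow> 'a" where
  "christoffel g p X Y =
     (THE Z. \<forall>W. g p Z W =
        (frechet_derivative (\<lambda>q. g q Y W) (at p) X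
         + frechet_derivative (\<lambda>q. g q X W) (at p) Y
         - frechet_derivative (\<lambda>q. g q X Y) (at p) W) / 2)"

definition cov_deriv :: "'a::euclidean_space metric_field \<Rightarrow> ('a \<Rightarrow> 'a) \<Rightarrow> 'a \<Rightarrow> 'a \<Rightarrow> 'a" where
  "cov_deriv g Y p X = frechet_derivative Y (at p) X + christoffel g p X (Y p)"

text \<open>The divergence is the trace of the endomorphism \<open>X \<mapsto> \<nabla>\<^sub>X Y\<close>; the trace does not depend
  on the basis, so the Euclidean one is used.\<close>

definition riem_div :: "'a::euclidean_space metric_field \<Rightarrow> ('a \<Rightarrow> 'a) \<Rightarrow> 'a \<Rightarrow> real" where
  "riem_div g Y p = (\<Sum>b\<in>Basis. cov_deriv g Y p b \<bullet> b)"

definition laplace_beltrami :: "'a::euclidean_space metric_field \<Rightarrow> ('a \<Rightarrow> real) \<Rightarrow> 'a \<Rightarrow> real" where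
  "laplace_beltrami g f = riem_div g (riem_grad g f)"

primrec Ck_on :: "nat \<Rightarrow> 'a::euclidean_space set \<Rightarrow> ('a \<Rightarrow> real) \<Rightarrow> bool" where
  "Ck_on 0 U f = continuous_on U f"
| "Ck_on (Suc n) U f =
     ((\<forall>x\<in>U. f differentiable (at x)) \<and>
      (\<forall>w. Ck_on n U (\<lambda>x. frechet_derivative f (at x) w)))"

definition smooth_on :: "'a::euclidean_space set \<Rightarrow> ('a \<Rightarrow> real) \<Rightarrow> bool" where
  "smooth_on U f \<longleftrightarrow> (\<forall>n. Ck_on n U f)"

text \<open>The image of \<open>F\<close> need not be open, so derivatives are taken within it (one-sided at
  end points).\<close>

definition C2_within :: "real set \<Rightarrow> (real \<Rightarrow> real) \<Rightarrow> bool" where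
  "C2_within S b \<longleftrightarrow>
     (\<exists>b' b''. (\<forall>x\<in>S. (b has_real_derivative b' x) (at x within S)) \<and>
               (\<forall>x\<in>S. (b' has_real_derivative b'' x) (at x within S)) \<and>
               continuous_on S b'')"

definition isoparametric :: "'a::euclidean_space set \<Rightarrow> 'a metric_field \<Rightarrow> ('a \<Rightarrow> real) \<Rightarrow> bool" where
  "isoparametric U g F \<longleftrightarrow>
     smooth_on U F \<and>
     (\<exists>a. continuous_on (F ` U) a \<and> (\<forall>p\<in>U. laplace_beltrami g F p = a (F p))) \<and>
     (\<exists>b. C2_within (F ` U) b \<and>
          (\<forall>p\<in>U. g p (riem_grad g F p) (riem_grad g F p) = b (F p)))"

definition regular_level_sets :: "'a::euclidean_space set \<Rightarrow> ('a \<Rightarrow> real) \<Rightarrow> 'a set set" where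
  "regular_level_sets U F =
     {{p \<in> U. F p = c} |c. c \<in> F ` U \<and>
        (\<forall>p\<in>U. F p = c \<longrightarrow> (\<exists>w. frechet_derivative F (at p) w \<noteq> 0))}"

text \<open>Polynomial functions in the coordinates \<open>x \<bullet> b\<close>; \<open>m\<close> ranges over exponent vectors.\<close>

definition polynomial_of_degree_le :: "nat \<Rightarrow> ('a::euclidean_space \<Rightarrow> real) \<Rightarrow> bool" where
  "polynomial_of_degree_le d P \<longleftrightarrow>
     (\<exists>(A :: ('a \<Rightarrow> nat) set) c. finite A \<and> (\<forall>m\<in>A. (\<Sum>b\<in>Basis. m b) \<le> d) \<and>
        (\<forall>x. P x = (\<Sum>m\<in>A. c m * (\<Prod>b\<in>Basis. (x \<bullet> b) ^ m b))))"


section \<open>The half-space model of complex hyperbolic space\<close>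

text \<open>
  Here \<open>k = CARD('k)\<close>, and \<open>e\<close> is a distinguished index. Since Isabelle's finite index types are
  nonempty, \<open>complex ^ 'n\<close> cannot be zero-dimensional; to include \<open>k = 1\<close>, the space
  \<open>C^(k-1)\<close> is realised as the vectors in \<open>complex ^ 'k\<close> with vanishing \<open>e\<close>-component, and the
  triple \<open>(v, z, t)\<close> as the vector with \<open>e\<close>-component \<open>z + i t\<close> and the other components those
  of \<open>v\<close>. The same decomposition applies to tangent vectors.
  The library inner product on \<open>complex ^ 'k\<close> is the real one, the real part of the
  Hermitian product.
\<close>

definition vpart :: "'k \<Rightarrow> complex ^ 'k::finite \<Rightarrow> complex ^ 'k" where
  "vpart e p = (\<chi> j. if j = e then 0 else p $ j)"

definition zpart :: "'k \<Rightarrow> complex ^ 'k::finite \<Rightarrow> real" where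
  "zpart e p = Re (p $ e)"

definition tpart :: "'k \<Rightarrow> complex ^ 'k::finite \<Rightarrow> real" where
  "tpart e p = Im (p $ e)"

definition Re_vec :: "complex ^ 'k \<Rightarrow> complex ^ 'k::finite" where
  "Re_vec v = (\<chi> j. of_real (Re (v $ j)))"

definition Im_vec :: "complex ^ 'k \<Rightarrow> complex ^ 'k::finite" where
  "Im_vec v = (\<chi> j. of_real (Im (v $ j)))"

definition bracket :: "complex ^ 'k \<Rightarrow> complex ^ 'k::finite \<Rightarrow> real" where
  "bracket v w = (\<i> *s v) \<bullet> w"

definition CH :: "'k \<Rightarrow> (complex ^ 'k::finite) set" where
  "CH e = {p. tpart e p > 0}"

definition CH_metric :: "'k \<Rightarrow> (complex ^ 'k::finite) metric_field" where
  "CH_metric e p X Y =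
     1 / tpart e p * (vpart e X \<bullet> vpart e Y)
     + 1 / (tpart e p)\<^sup>2 *
       ((zpart e X + 1/2 * bracket (vpart e X) (vpart e p)) *
        (zpart e Y + 1/2 * bracket (vpart e Y) (vpart e p)))
     + tpart e X * tpart e Y / (tpart e p)\<^sup>2"

definition RH :: "'k \<Rightarrow> (complex ^ 'k::finite) set" where
  "RH e = {p \<in> CH e. Im_vec (vpart e p) = 0 \<and> zpart e p = 0}"

definition cosh2_dist :: "'k \<Rightarrow> complex ^ 'k::finite \<Rightarrow> real" where
  "cosh2_dist e p =
     1 / (tpart e p)\<^sup>2 *
     ((tpart e p + 1/2 * (norm (Im_vec (vpart e p)))\<^sup>2)\<^sup>2
      + (norm (zpart e p - 1/2 * bracket (Re_vec (vpart e p)) (\<i> *s Im_vec (vpart e p))))\<^sup>2)"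

end

(*
  In the coordinates v = x + i y, w = z - x.y/2 put u = |y|^2/(2 t) and s = w/t, so that the claimed
  function is F = (1 + u)^2 + s^2.  Its gradient is explicit, and |grad F|^2 = 4 F (F - 1), which makes
  arcosh (sqrt F) 1-Lipschitz along curves; since F = 1 exactly on RH^k, this bounds the distance from
  below.  The bound is attained by an explicit unit speed geodesic, which
  was found by writing the point in homogeneous coordinates as X cosh (r/2) + i N sinh (r/2) with real
  vectors X and N.  The Laplacian is 2 (k + 2) F - 4: it is the divergence of the gradient, and the
  trace of the connection is computed in an orthonormal frame, where only the derivative of the metric
  in the direction of the field survives.
*)
theory Submission
  imports Defs
begin

section \<open>Polynomial functions\<close>

lemma polynomial_of_degree_leI:
  fixes P :: "'a::euclidean_space \<Rightarrow> real" and \<mu> :: "'i \<Rightarrow> 'a \<Rightarrow> nat"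
  assumes I: "finite I" and deg: "\<And>i. i \<in> I \<Longrightarrow> (\<Sum>b\<in>Basis. \<mu> i b) \<le> d"
    and P: "\<And>x. P x = (\<Sum>i\<in>I. c i * (\<Prod>b\<in>Basis. (x \<bullet> b) ^ \<mu> i b))"
  shows "polynomial_of_degree_le d P"
  unfolding polynomial_of_degree_le_def
proof (intro exI conjI allI ballI)
  show "finite (\<mu> ` I)" using I by simp
  show "(\<Sum>b\<in>Basis. m b) \<le> d" if "m \<in> \<mu> ` I" for m using that deg by auto
  fix x
  have "P x = (\<Sum>m\<in>\<mu> ` I. \<Sum>i | i \<in> I \<and> \<mu> i = m. c i * (\<Prod>b\<in>Basis. (x \<bullet> b) ^ \<mu> i b))"
    unfolding P by (rule sum.image_gen[OF I])
  also have "\<dots> = (\<Sum>m\<in>\<mu> ` I. (\<Sum>i | i \<in> I \<and> \<mu> i = m. c i) * (\<Prod>b\<in>Basis. (x \<bullet> b) ^ m b))"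
    by (simp add: sum_distrib_right)
  finally show "P x = (\<Sum>m\<in>\<mu> ` I. (\<Sum>i | i \<in> I \<and> \<mu> i = m. c i) * (\<Prod>b\<in>Basis. (x \<bullet> b) ^ m b))" .
qed

lemma polynomial_of_degree_le_add:
  fixes P Q :: "'a::euclidean_space \<Rightarrow> real"
  assumes "polynomial_of_degree_le d P" "polynomial_of_degree_le d Q"
  shows "polynomial_of_degree_le d (\<lambda>x. P x + Q x)"
proof -
  obtain A c where A: "finite A" "\<And>m. m \<in> A \<Longrightarrow> (\<Sum>b\<in>Basis. m b) \<le> d"
      "\<And>x. P x = (\<Sum>m\<in>A. c m * (\<Prod>b\<in>Basis. (x \<bullet> b) ^ m b))"
    using assms(1) unfolding polynomial_of_degree_le_def by metis
  obtain B c' where B: "finite B" "\<And>m. m \<in> B \<Longrightarrow> (\<Sum>b\<in>Basis. m b) \<le> d"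
      "\<And>x. Q x = (\<Sum>m\<in>B. c' m * (\<Prod>b\<in>Basis. (x \<bullet> b) ^ m b))"
    using assms(2) unfolding polynomial_of_degree_le_def by metis
  show ?thesis
  proof (rule polynomial_of_degree_leI)
    show "finite (A <+> B)" using A(1) B(1) by simp
    show "(\<Sum>b\<in>Basis. case_sum id id i b) \<le> d" if "i \<in> A <+> B" for i
      using that A(2) B(2) by auto
    show "P x + Q x = (\<Sum>i\<in>A <+> B. case_sum c c' i * (\<Prod>b\<in>Basis. (x \<bullet> b) ^ case_sum id id i b))" for x
      using A(1) B(1) by (simp add: A(3) B(3) sum.Plus)
  qed
qed

lemma polynomial_of_degree_le_mult:
  fixes P Q :: "'a::euclidean_space \<Rightarrow> real"
  assumes "polynomial_of_degree_le d P" "polynomial_of_degree_le d' Q"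
  shows "polynomial_of_degree_le (d + d') (\<lambda>x. P x * Q x)"
proof -
  obtain A c where A: "finite A" "\<And>m. m \<in> A \<Longrightarrow> (\<Sum>b\<in>Basis. m b) \<le> d"
      "\<And>x. P x = (\<Sum>m\<in>A. c m * (\<Prod>b\<in>Basis. (x \<bullet> b) ^ m b))"
    using assms(1) unfolding polynomial_of_degree_le_def by metis
  obtain B c' where B: "finite B" "\<And>m. m \<in> B \<Longrightarrow> (\<Sum>b\<in>Basis. m b) \<le> d'"
      "\<And>x. Q x = (\<Sum>m\<in>B. c' m * (\<Prod>b\<in>Basis. (x \<bullet> b) ^ m b))"
    using assms(2) unfolding polynomial_of_degree_le_def by metis
  show ?thesis
  proof (rule polynomial_of_degree_leI)
    show "finite (A \<times> B)" using A(1) B(1) by simp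
    show "(\<Sum>b\<in>Basis. fst i b + snd i b) \<le> d + d'" if "i \<in> A \<times> B" for i
      using that A(2)[of "fst i"] B(2)[of "snd i"] by (auto simp: sum.distrib)
    show "P x * Q x = (\<Sum>i\<in>A \<times> B. (c (fst i) * c' (snd i)) *
        (\<Prod>b\<in>Basis. (x \<bullet> b) ^ (fst i b + snd i b)))" for x
      unfolding A(3) B(3) sum_product sum.cartesian_product
      by (intro sum.cong) (auto simp: power_add prod.distrib)
  qed
qed

lemma polynomial_of_degree_le_mono:
  "polynomial_of_degree_le d P \<Longrightarrow> d \<le> d' \<Longrightarrow> polynomial_of_degree_le d' P"
  unfolding polynomial_of_degree_le_def by (meson le_trans)

lemma polynomial_of_degree_le_const: "polynomial_of_degree_le 0 (\<lambda>x. c)"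
  by (rule polynomial_of_degree_leI[where I = "{()}" and \<mu> = "\<lambda>_ _. 0" and c = "\<lambda>_. c"]) auto

lemma polynomial_of_degree_le_coordinate:
  assumes "b \<in> Basis"
  shows "polynomial_of_degree_le 1 (\<lambda>x. x \<bullet> b)"
  using assms
  by (intro polynomial_of_degree_leI[where I = "{()}" and \<mu> = "\<lambda>_ b'. if b' = b then 1 else 0" and c = "\<lambda>_. 1"])
    (auto simp: if_distrib[where f = "\<lambda>n. _ ^ n"] cong: if_cong)

lemma polynomial_of_degree_le_power:
  "polynomial_of_degree_le d P \<Longrightarrow> polynomial_of_degree_le (d * n) (\<lambda>x. P x ^ n)"
  by (induction n) (auto simp: polynomial_of_degree_le_const dest: polynomial_of_degree_le_mult)

lemma polynomial_of_degree_le_sum: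
  assumes "finite I" "\<And>i. i \<in> I \<Longrightarrow> polynomial_of_degree_le d (f i)"
  shows "polynomial_of_degree_le d (\<lambda>x. \<Sum>i\<in>I. f i x)"
  using assms
proof (induction I rule: finite_induct)
  case empty
  then show ?case using polynomial_of_degree_le_mono[OF polynomial_of_degree_le_const] by simp
next
  case (insert i I)
  then show ?case by (simp add: polynomial_of_degree_le_add)
qed

lemma polynomial_of_degree_le_growth:
  fixes v :: "'a::euclidean_space"
  assumes "polynomial_of_degree_le d P"
  shows "\<exists>C. \<forall>r\<ge>1. P (r *\<^sub>R v) \<le> C * r ^ d"
proof -
  obtain A c where A: "finite A" "\<And>m. m \<in> A \<Longrightarrow> (\<Sum>b\<in>Basis. m b) \<le> d"
      "\<And>x. P x = (\<Sum>m\<in>A. c m * (\<Prod>b\<in>Basis. (x \<bullet> b) ^ m b))"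
    using assms(1) unfolding polynomial_of_degree_le_def by metis
  define C where "C = (\<Sum>m\<in>A. \<bar>c m * (\<Prod>b\<in>Basis. (v \<bullet> b) ^ m b)\<bar>)"
  have "P (r *\<^sub>R v) \<le> C * r ^ d" if r: "r \<ge> 1" for r
  proof -
    have "P (r *\<^sub>R v) = (\<Sum>m\<in>A. (c m * (\<Prod>b\<in>Basis. (v \<bullet> b) ^ m b)) * r ^ (\<Sum>b\<in>Basis. m b))"
      by (simp add: A(3) power_mult_distrib prod.distrib power_sum mult_ac)
    also have "\<dots> \<le> (\<Sum>m\<in>A. \<bar>c m * (\<Prod>b\<in>Basis. (v \<bullet> b) ^ m b)\<bar> * r ^ d)"
      using r by (intro sum_mono mult_mono power_increasing A(2)) auto
    finally show ?thesis by (simp add: C_def sum_distrib_right)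
  qed
  then show ?thesis by blast
qed

section \<open>Functions of class \<open>C\<^sup>k\<close>\<close>

lemma Ck_on_cong:
  assumes "open U" "\<And>x. x \<in> U \<Longrightarrow> f x = g x" "Ck_on n U f"
  shows "Ck_on n U g"
  using assms(2,3)
proof (induction n arbitrary: f g)
  case 0
  then show ?case by (simp cong: continuous_on_cong)
next
  case (Suc n)
  have d: "(g has_derivative frechet_derivative f (at x)) (at x)" if "x \<in> U" for x
    using has_derivative_transform_within_open[OF _ \<open>open U\<close> that, of f _ UNIV g] Suc.prems that
    by (auto simp: frechet_derivative_works)
  then have eq: "frechet_derivative g (at x) = frechet_derivative f (at x)" if "x \<in> U" for x
    using that by (metis frechet_derivative_at)
  show ?case
    using Suc.prems d eq Suc.IH[of "\<lambda>x. frechet_derivative f (at x) w" "\<lambda>x. frechet_derivative g (at x) w" for w]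
    by (auto simp: differentiable_def)
qed

lemma Ck_onI:
  assumes "open U" "\<And>x. x \<in> U \<Longrightarrow> (f has_derivative f' x) (at x)"
    and "\<And>w. Ck_on n U (\<lambda>x. f' x w)"
  shows "Ck_on (Suc n) U f"
proof -
  have "frechet_derivative f (at x) = f' x" if "x \<in> U" for x
    using assms(2)[OF that] by (metis frechet_derivative_at)
  then show ?thesis
    using assms(2,3) Ck_on_cong[OF assms(1), of "\<lambda>x. f' x w" "\<lambda>x. frechet_derivative f (at x) w" for w]
    by (auto simp: differentiable_def)
qed

lemma Ck_on_has_derivative:
  "Ck_on (Suc n) U f \<Longrightarrow> x \<in> U \<Longrightarrow> (f has_derivative frechet_derivative f (at x)) (at x)"
  by (simp add: frechet_derivative_works)

lemma Ck_on_SucD: "Ck_on (Suc n) U f \<Longrightarrow> Ck_on n U f"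
proof (induction n arbitrary: f)
  case 0
  then show ?case
    by (auto intro!: continuous_at_imp_continuous_on differentiable_imp_continuous_within)
next
  case (Suc n)
  then show ?case by simp
qed

lemma Ck_on_const: "Ck_on n U (\<lambda>x. c)"
  by (induction n arbitrary: c) (auto simp: frechet_derivative_const)

lemma Ck_on_bounded_linear:
  assumes "bounded_linear f"
  shows "Ck_on n U f"
proof (cases n)
  case 0
  then show ?thesis using assms by (simp add: linear_continuous_on)
next
  case (Suc m)
  have "(f has_derivative f) (at x)" for x
    using assms by (rule bounded_linear_imp_has_derivative)
  moreover from this have "frechet_derivative f (at x) = f" for x
    by (metis frechet_derivative_at)
  ultimately show ?thesis by (auto simp: Suc differentiable_def Ck_on_const)
qed

lemma Ck_on_add:
  assumes "open U" "Ck_on n U f" "Ck_on n U g"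
  shows "Ck_on n U (\<lambda>x. f x + g x)"
  using assms(2,3)
proof (induction n arbitrary: f g)
  case 0
  then show ?case by (simp add: continuous_on_add)
next
  case (Suc n)
  show ?case
    by (rule Ck_onI[OF \<open>open U\<close> has_derivative_add[OF Suc.prems[THEN Ck_on_has_derivative]]])
      (use Suc in auto)
qed

lemma Ck_on_mult:
  assumes "open U" "Ck_on n U f" "Ck_on n U g"
  shows "Ck_on n U (\<lambda>x. f x * g x)"
  using assms(2,3)
proof (induction n arbitrary: f g)
  case 0
  then show ?case by (simp add: continuous_on_mult)
next
  case (Suc n)
  show ?case
    by (rule Ck_onI[OF \<open>open U\<close> has_derivative_mult[OF Suc.prems[THEN Ck_on_has_derivative]]])
      (use Suc Ck_on_SucD[OF Suc.prems(1)] Ck_on_SucD[OF Suc.prems(2)]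
        in \<open>auto intro!: Ck_on_add \<open>open U\<close>\<close>)
qed

lemma Ck_on_inverse:
  assumes "open U" "Ck_on n U f" "\<And>x. x \<in> U \<Longrightarrow> f x \<noteq> 0"
  shows "Ck_on n U (\<lambda>x. inverse (f x))"
  using assms(2)
proof (induction n)
  case 0
  then show ?case using assms(3) by (auto intro!: continuous_on_inverse)
next
  case (Suc n)
  have inv: "Ck_on n U (\<lambda>x. inverse (f x))"
    using Suc.IH Ck_on_SucD[OF Suc.prems] by blast
  have der: "((\<lambda>x. inverse (f x)) has_derivative
      (\<lambda>h. - (inverse (f x) * frechet_derivative f (at x) h * inverse (f x)))) (at x)" if "x \<in> U" for x
    by (rule Deriv.has_derivative_inverse[OF assms(3)[OF that] Ck_on_has_derivative[OF Suc.prems that]])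
  show ?case
  proof (rule Ck_onI[OF \<open>open U\<close> der])
    fix w
    have "Ck_on n U (\<lambda>x. (- 1) * (inverse (f x) * frechet_derivative f (at x) w * inverse (f x)))"
      using Suc.prems inv by (intro Ck_on_mult Ck_on_const \<open>open U\<close>) auto
    then show "Ck_on n U (\<lambda>x. - (inverse (f x) * frechet_derivative f (at x) w * inverse (f x)))"
      by simp
  qed
qed

lemma Ck_on_power:
  assumes "open U" "Ck_on n U f"
  shows "Ck_on n U (\<lambda>x. f x ^ m)"
  using assms by (induction m) (auto intro: Ck_on_const Ck_on_mult)

lemma Ck_on_sum:
  assumes "open U" "\<And>i. i \<in> I \<Longrightarrow> Ck_on n U (f i)"
  shows "Ck_on n U (\<lambda>x. \<Sum>i\<in>I. f i x)"
  using assms by (induction I rule: infinite_finite_induct) (auto intro: Ck_on_const Ck_on_add)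

section \<open>Gradient and divergence for a metric given by an orthonormal coframe\<close>

lemma frechet_derivative_eq:
  "(f has_derivative f') (at x) \<Longrightarrow> frechet_derivative f (at x) v = f' v"
  by (drule frechet_derivative_at) simp

lemma trace_conjugate:
  fixes A L M :: "'a::euclidean_space \<Rightarrow> 'a"
  assumes A: "linear A" and L: "linear L" and M: "linear M" and M_L: "\<And>x. M (L x) = x"
  shows "(\<Sum>b\<in>Basis. A b \<bullet> b) = (\<Sum>b\<in>Basis. L (A (M b)) \<bullet> b)"
proof -
  have LA: "linear (\<lambda>x. L (A x))" using linear_compose[OF A L] by (simp add: o_def)
  have "(\<Sum>b\<in>Basis. L (A (M b)) \<bullet> b) = (\<Sum>b\<in>Basis. \<Sum>c\<in>Basis. (M b \<bullet> c) * (L (A c) \<bullet> b))"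
  proof (rule sum.cong)
    fix b :: 'a
    have "L (A (M b)) = (\<Sum>c\<in>Basis. (M b \<bullet> c) *\<^sub>R L (A c))"
      by (subst euclidean_representation[of "M b", symmetric])
        (simp add: linear_sum[OF LA] linear_scale[OF LA])
    then show "L (A (M b)) \<bullet> b = (\<Sum>c\<in>Basis. (M b \<bullet> c) * (L (A c) \<bullet> b))"
      by (simp add: inner_sum_left)
  qed simp
  also have "\<dots> = (\<Sum>c\<in>Basis. \<Sum>b\<in>Basis. (M b \<bullet> c) * (L (A c) \<bullet> b))"
    by (rule sum.swap)
  also have "\<dots> = (\<Sum>c\<in>Basis. A c \<bullet> c)"
  proof (rule sum.cong)
    fix c :: 'a
    have "A c = M (\<Sum>b\<in>Basis. (L (A c) \<bullet> b) *\<^sub>R b)" by (simp add: euclidean_representation M_L)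
    also have "\<dots> = (\<Sum>b\<in>Basis. (L (A c) \<bullet> b) *\<^sub>R M b)"
      by (simp add: linear_sum[OF M] linear_scale[OF M])
    finally have "A c \<bullet> c = (\<Sum>b\<in>Basis. (L (A c) \<bullet> b) *\<^sub>R M b) \<bullet> c" by simp
    then show "(\<Sum>b\<in>Basis. (M b \<bullet> c) * (L (A c) \<bullet> b)) = A c \<bullet> c"
      by (simp add: inner_sum_left mult.commute)
  qed simp
  finally show ?thesis by simp
qed

text \<open>\<open>L\<close> is an orthonormal coframe at \<open>p\<close>, with dual frame \<open>M\<close>.\<close>

locale coframed_metric =
  fixes g :: "'a::euclidean_space metric_field" and p :: 'a and L M :: "'a \<Rightarrow> 'a"
  assumes linear_L: "linear L" and linear_M: "linear M"
    and L_M: "L (M x) = x" and M_L: "M (L x) = x"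
    and metric_eq: "g p X Y = L X \<bullet> L Y"
    and metric_commute: "g q X Y = g q Y X"
    and metric_linear: "linear (g q X)"
    and metric_differentiable: "(\<lambda>q. g q X Y) differentiable (at p)"
begin

lemma metric_eqI:
  assumes "\<And>W. g p X W = g p Y W"
  shows "X = Y"
proof -
  have "L X \<bullet> V = L Y \<bullet> V" for V
    using assms[of "M V"] by (simp add: metric_eq L_M)
  then have "L X = L Y" using vector_eq_rdot by blast
  then show ?thesis by (metis M_L)
qed

lemma riesz:
  assumes f: "linear f"
  shows "\<exists>!Z. \<forall>W. g p Z W = f W"
proof (rule ex_ex1I)
  have fM: "linear (\<lambda>x. f (M x))" using linear_compose[OF linear_M f] by (simp add: o_def)
  have "g p (M (\<Sum>b\<in>Basis. f (M b) *\<^sub>R b)) W = f W" for W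
  proof -
    have "f W = f (M (\<Sum>b\<in>Basis. (L W \<bullet> b) *\<^sub>R b))" by (simp add: euclidean_representation M_L)
    also have "\<dots> = (\<Sum>b\<in>Basis. (L W \<bullet> b) * f (M b))"
      by (simp add: linear_sum[OF fM] linear_scale[OF fM])
    finally show ?thesis
      by (simp add: metric_eq L_M inner_sum_left inner_commute[of "L W"] mult.commute)
  qed
  then show "\<exists>Z. \<forall>W. g p Z W = f W" by blast
next
  show "Z = Z'" if "\<forall>W. g p Z W = f W" "\<forall>W. g p Z' W = f W" for Z Z'
    using that by (intro metric_eqI) simp
qed

lemma riem_grad_eq:
  assumes "\<And>W. g p G W = frechet_derivative f (at p) W"
  shows "riem_grad g f p = G"
  unfolding riem_grad_def
proof (rule the_equality)
  show "\<forall>W. g p G W = frechet_derivative f (at p) W" using assms by blast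
  show "Z = G" if "\<forall>W. g p Z W = frechet_derivative f (at p) W" for Z
    using that assms by (intro metric_eqI) simp
qed

lemma linear_metric_derivative: "linear (\<lambda>Y. frechet_derivative (\<lambda>q. g q X Y) (at p) V)"
proof (rule linearI)
  fix Y Z :: 'a and c :: real
  have d: "((\<lambda>q. g q X Y) has_derivative frechet_derivative (\<lambda>q. g q X Y) (at p)) (at p)" for Y
    using metric_differentiable by (simp add: frechet_derivative_works)
  have "((\<lambda>q. g q X (Y + Z)) has_derivative (\<lambda>V. frechet_derivative (\<lambda>q. g q X Y) (at p) V
      + frechet_derivative (\<lambda>q. g q X Z) (at p) V)) (at p)"
    unfolding linear_add[OF metric_linear] by (intro has_derivative_add d)
  then show "frechet_derivative (\<lambda>q. g q X (Y + Z)) (at p) V =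
      frechet_derivative (\<lambda>q. g q X Y) (at p) V + frechet_derivative (\<lambda>q. g q X Z) (at p) V"
    by (rule frechet_derivative_eq)
  have "((\<lambda>q. g q X (c *\<^sub>R Y)) has_derivative
      (\<lambda>V. c *\<^sub>R frechet_derivative (\<lambda>q. g q X Y) (at p) V)) (at p)"
    unfolding linear_scale[OF metric_linear] by (intro has_derivative_scaleR_right d)
  then show "frechet_derivative (\<lambda>q. g q X (c *\<^sub>R Y)) (at p) V =
      c *\<^sub>R frechet_derivative (\<lambda>q. g q X Y) (at p) V"
    by (rule frechet_derivative_eq)
qed

lemma linear_metric_derivative': "linear (\<lambda>X. frechet_derivative (\<lambda>q. g q X Y) (at p) V)"
  using linear_metric_derivative[of Y V] by (subst metric_commute)

lemma linear_frechet_derivative_metric: "linear (frechet_derivative (\<lambda>q. g q X Y) (at p))"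
  using metric_differentiable by (rule linear_frechet_derivative)

lemma christoffel_koszul:
  "g p (christoffel g p X Y) W =
     (frechet_derivative (\<lambda>q. g q Y W) (at p) X + frechet_derivative (\<lambda>q. g q X W) (at p) Y
      - frechet_derivative (\<lambda>q. g q X Y) (at p) W) / 2"
proof -
  have "linear (\<lambda>W. (frechet_derivative (\<lambda>q. g q Y W) (at p) X
      + frechet_derivative (\<lambda>q. g q X W) (at p) Y
      - frechet_derivative (\<lambda>q. g q X Y) (at p) W) / 2)"
    by (rule linearI)
      (simp_all add: linear_add[OF linear_metric_derivative] linear_scale[OF linear_metric_derivative]
        linear_add[OF linear_frechet_derivative_metric] linear_scale[OF linear_frechet_derivative_metric]
        algebra_simps add_divide_distrib diff_divide_distrib)
  from theI'[OF riesz[OF this]] show ?thesis unfolding christoffel_def by blast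
qed

lemma linear_christoffel: "linear (\<lambda>X. christoffel g p X Y)"
proof (rule linearI)
  fix X X' :: 'a and c :: real
  have lin: "linear (\<lambda>X. g p X W)" for W using metric_linear[of p W] by (subst metric_commute)
  show "christoffel g p (X + X') Y = christoffel g p X Y + christoffel g p X' Y"
    by (rule metric_eqI)
      (simp add: linear_add[OF lin] christoffel_koszul linear_add[OF linear_metric_derivative']
        linear_add[OF linear_frechet_derivative_metric] algebra_simps add_divide_distrib diff_divide_distrib)
  show "christoffel g p (c *\<^sub>R X) Y = c *\<^sub>R christoffel g p X Y"
    by (rule metric_eqI)
      (simp add: linear_scale[OF lin] christoffel_koszul linear_scale[OF linear_metric_derivative']
        linear_scale[OF linear_frechet_derivative_metric] algebra_simps add_divide_distrib diff_divide_distrib)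
qed

text \<open>In the trace of the Koszul formula over the frame the first and the last term cancel.\<close>

lemma trace_christoffel:
  "(\<Sum>b\<in>Basis. christoffel g p b Y \<bullet> b) =
     (\<Sum>b\<in>Basis. frechet_derivative (\<lambda>q. g q (M b) (M b)) (at p) Y) / 2"
proof -
  have "(\<Sum>b\<in>Basis. christoffel g p b Y \<bullet> b) = (\<Sum>b\<in>Basis. L (christoffel g p (M b) Y) \<bullet> b)"
    by (rule trace_conjugate[OF linear_christoffel linear_L linear_M M_L])
  also have "\<dots> = (\<Sum>b\<in>Basis. g p (christoffel g p (M b) Y) (M b))"
    by (simp add: metric_eq L_M)
  also have "\<dots> = (\<Sum>b\<in>Basis. frechet_derivative (\<lambda>q. g q (M b) (M b)) (at p) Y) / 2"
    by (simp add: christoffel_koszul metric_commute[of _ Y] sum_divide_distrib)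
  finally show ?thesis .
qed

end

section \<open>The half-space model in coordinates\<close>

definition sympl :: "'k \<Rightarrow> complex ^ 'k::finite \<Rightarrow> complex ^ 'k \<Rightarrow> real" where
  "sympl e X Y = (\<Sum>j\<in>-{e}. Re (X $ j) * Im (Y $ j) - Im (X $ j) * Re (Y $ j))"

text \<open>\<open>1/t \<cdot> contact e p\<close> is the component of the orthonormal coframe in the direction of the
  centre of the Heisenberg group.\<close>

definition contact :: "'k \<Rightarrow> complex ^ 'k::finite \<Rightarrow> complex ^ 'k \<Rightarrow> real" where
  "contact e p X = zpart e X + sympl e X p / 2"

definition coframe :: "'k \<Rightarrow> complex ^ 'k::finite \<Rightarrow> complex ^ 'k \<Rightarrow> complex ^ 'k" where
  "coframe e p X = (\<chi> j. if j = e then Complex (contact e p X / tpart e p) (tpart e X / tpart e p)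
                         else X $ j /\<^sub>R sqrt (tpart e p))"

definition frame :: "'k \<Rightarrow> complex ^ 'k::finite \<Rightarrow> complex ^ 'k \<Rightarrow> complex ^ 'k" where
  "frame e p X = (\<chi> j. if j = e
      then Complex (tpart e p * zpart e X - sqrt (tpart e p) * sympl e X p / 2) (tpart e p * tpart e X)
      else sqrt (tpart e p) *\<^sub>R (X $ j))"

lemma sum_UNIV_split: "(\<Sum>j\<in>UNIV. f j) = f e + (\<Sum>j\<in>-{e}. f j)" for e :: "'k::finite"
  by (simp add: sum.remove[of UNIV e] Compl_eq_Diff_UNIV)

lemma sum_Compl_cong: "(\<And>j. j \<noteq> e \<Longrightarrow> f j = g j) \<Longrightarrow> (\<Sum>j\<in>-{e}. f j) = (\<Sum>j\<in>-{e}. g j)"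
  by (rule sum.cong) auto

lemma bracket_vpart: "bracket (vpart e X) (vpart e Y) = sympl e X Y"
  unfolding bracket_def sympl_def inner_vec_def sum_UNIV_split[where e = e]
  by (simp add: vpart_def inner_complex_def cong: sum_Compl_cong)

lemma inner_vpart: "vpart e X \<bullet> vpart e Y = (\<Sum>j\<in>-{e}. X $ j \<bullet> Y $ j)"
  unfolding inner_vec_def sum_UNIV_split[where e = e] by (simp add: vpart_def cong: sum_Compl_cong)

lemma CH_metric_eq:
  "CH_metric e p X Y = (\<Sum>j\<in>-{e}. X $ j \<bullet> Y $ j) / tpart e p
     + contact e p X * contact e p Y / (tpart e p)\<^sup>2 + tpart e X * tpart e Y / (tpart e p)\<^sup>2"
  by (simp add: CH_metric_def bracket_vpart inner_vpart contact_def)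

lemma bounded_linear_zpart: "bounded_linear (zpart e)"
  unfolding zpart_def by (intro bounded_linear_compose[OF bounded_linear_Re] bounded_linear_vec_nth)

lemma bounded_linear_tpart: "bounded_linear (tpart e)"
  unfolding tpart_def by (intro bounded_linear_compose[OF bounded_linear_Im] bounded_linear_vec_nth)

lemma bounded_linear_Re_nth: "bounded_linear (\<lambda>p. Re (p $ j))"
  by (intro bounded_linear_compose[OF bounded_linear_Re] bounded_linear_vec_nth)

lemma bounded_linear_Im_nth: "bounded_linear (\<lambda>p. Im (p $ j))"
  by (intro bounded_linear_compose[OF bounded_linear_Im] bounded_linear_vec_nth)

lemma bounded_linear_sympl: "bounded_linear (sympl e X)"
  unfolding sympl_def
  by (intro bounded_linear_sum bounded_linear_sub bounded_linear_const_mult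
      bounded_linear_Re_nth bounded_linear_Im_nth)

lemmas has_derivative_coordinates [derivative_intros] =
  bounded_linear.has_derivative[OF bounded_linear_zpart]
  bounded_linear.has_derivative[OF bounded_linear_tpart]
  bounded_linear.has_derivative[OF bounded_linear_sympl]
  bounded_linear.has_derivative[OF bounded_linear_vec_nth]

lemmas linear_tpart = bounded_linear.linear[OF bounded_linear_tpart]
lemmas linear_zpart = bounded_linear.linear[OF bounded_linear_zpart]

lemma sympl_commute: "sympl e Y X = - sympl e X Y"
  by (simp add: sympl_def sum_negf[symmetric] algebra_simps)

lemma linear_sympl_left: "linear (\<lambda>X. sympl e X Y)"
  unfolding sympl_commute[of e _ Y]
  by (intro linear_compose_neg bounded_linear.linear bounded_linear_sympl)

lemma linear_contact: "linear (contact e p)"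
  by (intro linearI) (simp_all add: contact_def linear_add[OF linear_zpart] linear_scale[OF linear_zpart]
    linear_add[OF linear_sympl_left] linear_scale[OF linear_sympl_left] algebra_simps add_divide_distrib)

lemma linear_CH_metric: "linear (CH_metric e p X)"
  by (rule linearI)
    (simp_all add: CH_metric_eq linear_add[OF linear_contact] linear_scale[OF linear_contact]
      linear_add[OF linear_tpart] linear_scale[OF linear_tpart] inner_add_right sum.distrib
      sum_distrib_left distrib_left add_divide_distrib mult_ac)

lemma coframe_nth:
  "coframe e p X $ e = Complex (contact e p X / tpart e p) (tpart e X / tpart e p)"
  "j \<noteq> e \<Longrightarrow> coframe e p X $ j = X $ j /\<^sub>R sqrt (tpart e p)"
  by (simp_all add: coframe_def)

lemma frame_nth:
  "frame e p X $ e =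
     Complex (tpart e p * zpart e X - sqrt (tpart e p) * sympl e X p / 2) (tpart e p * tpart e X)"
  "j \<noteq> e \<Longrightarrow> frame e p X $ j = sqrt (tpart e p) *\<^sub>R (X $ j)"
  by (simp_all add: frame_def)

lemma sympl_frame: "sympl e (frame e p X) Y = sqrt (tpart e p) * sympl e X Y"
  unfolding sympl_def sum_distrib_left by (rule sum_Compl_cong) (simp add: frame_nth algebra_simps)

lemma sympl_coframe: "sympl e (coframe e p X) Y = sympl e X Y / sqrt (tpart e p)"
  unfolding sympl_def sum_divide_distrib
  by (rule sum_Compl_cong) (simp add: coframe_nth field_simps diff_divide_distrib)

lemma contact_frame: "contact e p (frame e p X) = tpart e p * zpart e X"
  unfolding contact_def sympl_frame by (simp add: zpart_def frame_nth)

lemma tpart_frame: "tpart e (frame e p X) = tpart e p * tpart e X"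
  by (simp add: tpart_def frame_nth)

lemma linear_coframe: "linear (coframe e p)"
  by (rule linearI; rule vec_eq_iff[THEN iffD2]; rule allI)
    (simp_all add: coframe_def linear_add[OF linear_contact] linear_scale[OF linear_contact]
      linear_add[OF linear_tpart] linear_scale[OF linear_tpart] complex_eq_iff
      add_divide_distrib scaleR_add_right)

lemma linear_frame: "linear (frame e p)"
  by (rule linearI; rule vec_eq_iff[THEN iffD2]; rule allI)
    (simp_all add: frame_def linear_add[OF linear_zpart] linear_scale[OF linear_zpart]
      linear_add[OF linear_tpart] linear_scale[OF linear_tpart]
      linear_add[OF linear_sympl_left] linear_scale[OF linear_sympl_left] complex_eq_iff
      algebra_simps add_divide_distrib)

lemma CH_metric_has_derivative:
  assumes "p \<in> CH e"
  shows "((\<lambda>q. CH_metric e q X Y) has_derivative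
    (\<lambda>V. - (\<Sum>j\<in>-{e}. X $ j \<bullet> Y $ j) * tpart e V / (tpart e p)\<^sup>2
       + (sympl e X V * contact e p Y + contact e p X * sympl e Y V) / (2 * (tpart e p)\<^sup>2)
       - 2 * (contact e p X * contact e p Y + tpart e X * tpart e Y) * tpart e V / (tpart e p)^3)) (at p)"
  unfolding CH_metric_eq contact_def using assms
  by (auto intro!: derivative_eq_intros ext simp: CH_def field_simps power2_eq_square power3_eq_cube)

lemma coframed_metric_CH:
  assumes p: "p \<in> CH e"
  shows "coframed_metric (CH_metric e) p (coframe e p) (frame e p)"
proof (rule coframed_metric.intro)
  have t: "tpart e p > 0" using p by (simp add: CH_def)
  show "linear (coframe e p)" "linear (frame e p)" by (fact linear_coframe linear_frame)+
  show "coframe e p (frame e p X) = X" for X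
    unfolding vec_eq_iff
    by (simp add: coframe_def contact_frame tpart_frame complex_eq_iff frame_nth)
      (use t in \<open>auto simp: zpart_def tpart_def\<close>)
  show "frame e p (coframe e p X) = X" for X
    unfolding vec_eq_iff using t
    by (auto simp: frame_def sympl_coframe complex_eq_iff coframe_nth zpart_def tpart_def contact_def)
  show "CH_metric e p X Y = coframe e p X \<bullet> coframe e p Y" for X Y
    unfolding inner_vec_def sum_UNIV_split[where e = e] using t
    by (simp add: coframe_nth CH_metric_eq inner_complex_def field_simps power2_eq_square
        sum_divide_distrib cong: sum_Compl_cong)
  show "CH_metric e q X Y = CH_metric e q Y X" for q X Y
    by (simp add: CH_metric_eq inner_commute mult.commute)
  show "linear (CH_metric e q X)" for q X by (rule linear_CH_metric)
  show "(\<lambda>q. CH_metric e q X Y) differentiable at p" for X Y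
    using CH_metric_has_derivative[OF p] differentiable_def by blast
qed

lemma sum_Basis_vec_complex:
  fixes f :: "complex ^ 'k::finite \<Rightarrow> real"
  shows "(\<Sum>b\<in>Basis. f b) = (\<Sum>j\<in>UNIV. f (axis j 1) + f (axis j \<i>))"
proof -
  have "(\<Sum>b\<in>Basis. f b) = (\<Sum>j\<in>UNIV. \<Sum>b\<in>(\<Union>u\<in>Basis. {axis j u}). f b)"
    unfolding Basis_vec_def by (rule sum.UNION_disjoint) (auto simp: axis_eq_axis)
  also have "\<dots> = (\<Sum>j\<in>UNIV. f (axis j 1) + f (axis j \<i>))"
    by (rule sum.cong) (simp_all add: Basis_complex_def axis_eq_axis)
  finally show ?thesis .
qed

lemma trace_christoffel_CH:
  fixes e :: "'k::finite"
  assumes p: "p \<in> CH e"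
  shows "(\<Sum>b\<in>Basis. christoffel (CH_metric e) p b Y \<bullet> b)
    = - (real CARD('k) + 1) * tpart e Y / tpart e p"
proof -
  interpret coframed_metric "CH_metric e" p "coframe e p" "frame e p"
    by (rule coframed_metric_CH[OF p])
  have t: "tpart e p > 0" using p by (simp add: CH_def)
  define w where "w b = (\<Sum>j\<in>-{e}. (norm (b $ j))\<^sup>2) + 2 * (norm (b $ e))\<^sup>2" for b :: "complex ^ 'k"
  have d: "frechet_derivative (\<lambda>q. CH_metric e q (frame e p b) (frame e p b)) (at p) Y
      = - w b * tpart e Y / tpart e p" if "b \<in> Basis" for b
  proof -
    have z: "zpart e b * sympl e b Y = 0"
      using that by (auto simp: Basis_vec_def zpart_def sympl_def axis_def intro!: sum.neutral split: if_splits)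
    have s: "(\<Sum>j\<in>-{e}. frame e p b $ j \<bullet> frame e p b $ j) = tpart e p * (\<Sum>j\<in>-{e}. (norm (b $ j))\<^sup>2)"
      unfolding sum_distrib_left using t
      by (intro sum_Compl_cong) (simp add: frame_nth power2_norm_eq_inner)
    have n: "(norm (b $ e))\<^sup>2 = zpart e b * zpart e b + tpart e b * tpart e b"
      by (simp add: zpart_def tpart_def cmod_power2 flip: power2_eq_square)
    have "sympl e (frame e p b) Y * contact e p (frame e p b) = 0"
      using z by (auto simp: sympl_frame contact_frame)
    then show ?thesis
      unfolding frechet_derivative_eq[OF CH_metric_has_derivative[OF p]] s w_def n
      using t by (simp add: contact_frame tpart_frame field_simps power2_eq_square power3_eq_cube)
  qed
  have "(\<Sum>j\<in>-{e}. w (axis j 1) + w (axis j \<i>)) = (\<Sum>j\<in>-{e}. 2)"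
  proof (rule sum_Compl_cong)
    fix j assume "j \<noteq> e"
    then have "(\<Sum>i\<in>-{e}. (norm (axis j u $ i :: complex))\<^sup>2) = (norm u)\<^sup>2" for u :: complex
      by (subst sum.mono_neutral_cong_right[of "-{e}" "{j}"]) (auto simp: axis_def)
    then show "w (axis j 1) + w (axis j \<i>) = 2" using \<open>j \<noteq> e\<close> by (simp add: w_def axis_def)
  qed
  moreover have "w (axis e 1) + w (axis e \<i>) = 4"
    by (simp add: w_def axis_def cong: sum_Compl_cong)
  moreover have "real (card (- {e})) = real CARD('k) - 1"
    by (simp add: Compl_eq_Diff_UNIV of_nat_diff Suc_leI)
  ultimately have "(\<Sum>b\<in>Basis. w b) = 2 * (real CARD('k) + 1)"
    unfolding sum_Basis_vec_complex sum_UNIV_split[where e = e] by simp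
  then show ?thesis
    unfolding trace_christoffel using t
    by (simp add: d sum_divide_distrib[symmetric] sum_distrib_right[symmetric] sum_negf field_simps)
qed

section \<open>The function \<open>cosh\<^sup>2 r\<close>\<close>

definition imsq :: "'k \<Rightarrow> complex ^ 'k::finite \<Rightarrow> real" where
  "imsq e p = (\<Sum>j\<in>-{e}. (Im (p $ j))\<^sup>2)"

definition reim :: "'k \<Rightarrow> complex ^ 'k::finite \<Rightarrow> real" where
  "reim e p = (\<Sum>j\<in>-{e}. Re (p $ j) * Im (p $ j))"

text \<open>\<open>u = |y|\<^sup>2 / (2 t)\<close> and \<open>s = w / t\<close>, with differentials \<open>duu\<close> and \<open>dss\<close>.\<close>

definition uu :: "'k \<Rightarrow> complex ^ 'k::finite \<Rightarrow> real" where
  "uu e p = imsq e p / (2 * tpart e p)"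

definition ss :: "'k \<Rightarrow> complex ^ 'k::finite \<Rightarrow> real" where
  "ss e p = (zpart e p - reim e p / 2) / tpart e p"

lemma norm_Im_vec: "(norm (Im_vec (vpart e p)))\<^sup>2 = imsq e p"
  unfolding power2_norm_eq_inner inner_vec_def sum_UNIV_split[where e = e] imsq_def
  by (simp add: Im_vec_def vpart_def inner_complex_def power2_eq_square cong: sum_Compl_cong)

lemma bracket_Re_Im: "bracket (Re_vec (vpart e p)) (\<i> *s Im_vec (vpart e p)) = reim e p"
  unfolding bracket_def inner_vec_def sum_UNIV_split[where e = e] reim_def
  by (simp add: Im_vec_def Re_vec_def vpart_def inner_complex_def cong: sum_Compl_cong)

lemma cosh2_dist_polynomial:
  "cosh2_dist e p = ((tpart e p + imsq e p / 2)\<^sup>2 + (zpart e p - reim e p / 2)\<^sup>2) / (tpart e p)\<^sup>2"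
  by (simp add: cosh2_dist_def norm_Im_vec bracket_Re_Im)

lemma cosh2_dist_eq:
  assumes "p \<in> CH e"
  shows "cosh2_dist e p = (1 + uu e p)\<^sup>2 + (ss e p)\<^sup>2"
proof -
  have "1 + uu e p = (tpart e p + imsq e p / 2) / tpart e p"
    using assms by (simp add: CH_def uu_def field_simps)
  then show ?thesis
    unfolding cosh2_dist_polynomial ss_def by (simp only: power_divide) (rule add_divide_distrib)
qed

lemma imsq_nonneg: "imsq e p \<ge> 0"
  by (simp add: imsq_def sum_nonneg)

lemma uu_nonneg: "p \<in> CH e \<Longrightarrow> uu e p \<ge> 0"
  by (simp add: uu_def CH_def imsq_nonneg)

lemma open_CH: "open (CH e)"
  unfolding CH_def
  by (intro open_Collect_less continuous_on_const linear_continuous_on bounded_linear_tpart)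

lemma Ck_on_cosh2_dist: "Ck_on n (CH e) (cosh2_dist e)"
proof -
  note lin = Ck_on_bounded_linear[OF bounded_linear_zpart] Ck_on_bounded_linear[OF bounded_linear_tpart]
    Ck_on_bounded_linear[OF bounded_linear_Re_nth] Ck_on_bounded_linear[OF bounded_linear_Im_nth]
  have "Ck_on n (CH e) (\<lambda>p. ((tpart e p + (1/2) * imsq e p)\<^sup>2 + (zpart e p + (-1/2) * reim e p)\<^sup>2)
      * inverse ((tpart e p)\<^sup>2))"
    unfolding imsq_def reim_def
    by (intro Ck_on_add Ck_on_mult Ck_on_power Ck_on_sum Ck_on_inverse Ck_on_const lin open_CH)
      (auto simp: CH_def)
  then show ?thesis
    by (rule Ck_on_cong[OF open_CH, rotated]) (simp add: cosh2_dist_polynomial field_class.field_divide_inverse[of _ "_ ^ 2"])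
qed

lemma imsq_has_derivative [derivative_intros]:
  assumes "(f has_derivative f') (at x within S)"
  shows "((\<lambda>x. imsq e (f x)) has_derivative
    (\<lambda>h. 2 * (\<Sum>j\<in>-{e}. Im (f x $ j) * Im (f' h $ j)))) (at x within S)"
  unfolding imsq_def sum_distrib_left
  by (intro has_derivative_sum has_derivative_eq_rhs[OF has_derivative_power[OF
          bounded_linear.has_derivative[OF bounded_linear_Im_nth assms]]]) (simp add: mult_ac)

lemma reim_has_derivative [derivative_intros]:
  assumes "(f has_derivative f') (at x within S)"
  shows "((\<lambda>x. reim e (f x)) has_derivative
    (\<lambda>h. (\<Sum>j\<in>-{e}. Re (f x $ j) * Im (f' h $ j)) + (\<Sum>j\<in>-{e}. Im (f x $ j) * Re (f' h $ j)))) (at x within S)"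
  unfolding reim_def sum.distrib[symmetric]
  by (intro has_derivative_sum has_derivative_eq_rhs[OF has_derivative_mult[OF
          bounded_linear.has_derivative[OF bounded_linear_Re_nth assms]
          bounded_linear.has_derivative[OF bounded_linear_Im_nth assms]]]) (simp add: mult.commute)

definition duu :: "'k \<Rightarrow> complex ^ 'k::finite \<Rightarrow> complex ^ 'k \<Rightarrow> real" where
  "duu e p h = ((\<Sum>j\<in>-{e}. Im (p $ j) * Im (h $ j)) - uu e p * tpart e h) / tpart e p"

definition dss :: "'k \<Rightarrow> complex ^ 'k::finite \<Rightarrow> complex ^ 'k \<Rightarrow> real" where
  "dss e p h = (zpart e h - ((\<Sum>j\<in>-{e}. Re (p $ j) * Im (h $ j)) + (\<Sum>j\<in>-{e}. Im (p $ j) * Re (h $ j))) / 2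
      - ss e p * tpart e h) / tpart e p"

lemma uu_has_derivative:
  assumes "p \<in> CH e"
  shows "(uu e has_derivative duu e p) (at p)"
  unfolding uu_def[abs_def] using assms
  by (intro has_derivative_eq_rhs[OF has_derivative_divide'[OF imsq_has_derivative[OF has_derivative_ident]
          has_derivative_mult_right[OF bounded_linear_imp_has_derivative[OF bounded_linear_tpart]]]] ext)
    (simp_all add: CH_def duu_def dss_def uu_def ss_def field_simps)

lemma ss_has_derivative:
  assumes "p \<in> CH e"
  shows "(ss e has_derivative dss e p) (at p)"
  unfolding ss_def[abs_def] using assms
  by (intro has_derivative_eq_rhs[OF has_derivative_divide'[OF has_derivative_diff[OF
            bounded_linear_imp_has_derivative[OF bounded_linear_zpart]
            bounded_linear.has_derivative[OF bounded_linear_divide reim_has_derivative[OF has_derivative_ident]]]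
          bounded_linear_imp_has_derivative[OF bounded_linear_tpart]]] ext)
    (simp_all add: CH_def duu_def dss_def uu_def ss_def field_simps)

lemma sum_of_squares_has_derivative:
  fixes u s :: "'a::real_normed_vector \<Rightarrow> real"
  assumes "(u has_derivative u') (at p)" "(s has_derivative s') (at p)"
  shows "((\<lambda>q. (1 + u q)\<^sup>2 + (s q)\<^sup>2) has_derivative
    (\<lambda>h. 2 * (1 + u p) * u' h + 2 * s p * s' h)) (at p)"
  using assms by (auto intro!: derivative_eq_intros)

definition dcosh2 :: "'k \<Rightarrow> complex ^ 'k::finite \<Rightarrow> complex ^ 'k \<Rightarrow> real" where
  "dcosh2 e p h = 2 * (1 + uu e p) * duu e p h + 2 * ss e p * dss e p h"

lemma cosh2_dist_has_derivative:
  assumes "p \<in> CH e"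
  shows "(cosh2_dist e has_derivative dcosh2 e p) (at p)"
proof (rule has_derivative_transform_within_open[OF _ open_CH assms cosh2_dist_eq[symmetric]])
  show "((\<lambda>p. (1 + uu e p)\<^sup>2 + (ss e p)\<^sup>2) has_derivative dcosh2 e p) (at p)"
    unfolding dcosh2_def[abs_def]
    by (rule sum_of_squares_has_derivative[OF uu_has_derivative[OF assms] ss_has_derivative[OF assms]])
qed

definition grad_cosh2 :: "'k \<Rightarrow> complex ^ 'k::finite \<Rightarrow> complex ^ 'k" where
  "grad_cosh2 e p = (\<chi> j. if j = e
      then Complex (2 * (1 + uu e p) * zpart e p)
        (- 2 * tpart e p * ((1 + uu e p)\<^sup>2 + (ss e p)\<^sup>2 - 1 - uu e p))
      else Complex (- 2 * ss e p * Im (p $ j)) (2 * (1 + uu e p) * Im (p $ j)))"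

lemma grad_cosh2_nth:
  "tpart e (grad_cosh2 e p) = - 2 * tpart e p * ((1 + uu e p)\<^sup>2 + (ss e p)\<^sup>2 - 1 - uu e p)"
  "zpart e (grad_cosh2 e p) = 2 * (1 + uu e p) * zpart e p"
  "j \<noteq> e \<Longrightarrow> grad_cosh2 e p $ j = Complex (- 2 * ss e p * Im (p $ j)) (2 * (1 + uu e p) * Im (p $ j))"
  by (simp_all add: grad_cosh2_def tpart_def zpart_def)

lemma imsq_eq: "p \<in> CH e \<Longrightarrow> imsq e p = 2 * uu e p * tpart e p"
  by (simp add: uu_def CH_def)

lemma zpart_eq: "p \<in> CH e \<Longrightarrow> zpart e p = ss e p * tpart e p + reim e p / 2"
  by (simp add: ss_def CH_def)

lemma contact_grad_cosh2:
  assumes "p \<in> CH e"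
  shows "contact e p (grad_cosh2 e p) = 2 * ss e p * tpart e p"
proof -
  have "sympl e (grad_cosh2 e p) p = - 2 * ss e p * imsq e p - 2 * (1 + uu e p) * reim e p"
    unfolding sympl_def imsq_def reim_def sum_distrib_left sum_subtractf[symmetric]
    by (rule sum_Compl_cong) (simp add: grad_cosh2_nth algebra_simps power2_eq_square)
  then show ?thesis
    using assms by (simp add: contact_def grad_cosh2_nth zpart_eq imsq_eq algebra_simps)
qed

lemma metric_grad_cosh2:
  assumes p: "p \<in> CH e"
  shows "CH_metric e p (grad_cosh2 e p) W = dcosh2 e p W"
proof -
  have t: "tpart e p > 0" using p by (simp add: CH_def)
  define a b c where "a = (\<Sum>j\<in>-{e}. Im (p $ j) * Im (W $ j))"
    and "b = (\<Sum>j\<in>-{e}. Re (p $ j) * Im (W $ j))" and "c = (\<Sum>j\<in>-{e}. Im (p $ j) * Re (W $ j))"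
  have 1: "(\<Sum>j\<in>-{e}. grad_cosh2 e p $ j \<bullet> W $ j) = - 2 * ss e p * c + 2 * (1 + uu e p) * a"
    unfolding a_def c_def sum_distrib_left sum.distrib[symmetric]
    by (rule sum_Compl_cong) (simp add: grad_cosh2_nth inner_complex_def)
  have 2: "sympl e W p = c - b"
    unfolding sympl_def b_def c_def sum_subtractf[symmetric] by (rule sum_Compl_cong) simp
  show ?thesis
    unfolding CH_metric_eq contact_grad_cosh2[OF p] 1 grad_cosh2_nth dcosh2_def duu_def dss_def
      a_def[symmetric] b_def[symmetric] c_def[symmetric]
    unfolding contact_def 2
    using t by (simp add: field_simps power2_eq_square)
qed

lemma riem_grad_cosh2_dist:
  assumes p: "p \<in> CH e"
  shows "riem_grad (CH_metric e) (cosh2_dist e) p = grad_cosh2 e p"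
  by (rule coframed_metric.riem_grad_eq[OF coframed_metric_CH[OF p]])
    (simp add: metric_grad_cosh2[OF p] frechet_derivative_eq[OF cosh2_dist_has_derivative[OF p]])

lemma norm_grad_cosh2:
  assumes p: "p \<in> CH e"
  shows "CH_metric e p (grad_cosh2 e p) (grad_cosh2 e p) = 4 * cosh2_dist e p * (cosh2_dist e p - 1)"
proof -
  have t: "tpart e p > 0" using p by (simp add: CH_def)
  have "(\<Sum>j\<in>-{e}. grad_cosh2 e p $ j \<bullet> grad_cosh2 e p $ j) =
      4 * ((1 + uu e p)\<^sup>2 + (ss e p)\<^sup>2) * imsq e p"
    unfolding imsq_def sum_distrib_left
    by (rule sum_Compl_cong) (simp add: grad_cosh2_nth inner_complex_def algebra_simps power2_eq_square)
  then show ?thesis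
    unfolding CH_metric_eq contact_grad_cosh2[OF p] cosh2_dist_eq[OF p] grad_cosh2_nth imsq_eq[OF p]
    using t by (simp add: field_simps power2_eq_square)
qed

definition dgrad_cosh2 :: "'k \<Rightarrow> complex ^ 'k::finite \<Rightarrow> complex ^ 'k \<Rightarrow> complex ^ 'k" where
  "dgrad_cosh2 e p h = (\<chi> j. if j = e
      then Complex (2 * (duu e p h * zpart e p + (1 + uu e p) * zpart e h))
        (- 2 * (tpart e h * ((1 + uu e p)\<^sup>2 + (ss e p)\<^sup>2 - 1 - uu e p)
                + tpart e p * (dcosh2 e p h - duu e p h)))
      else Complex (- 2 * (dss e p h * Im (p $ j) + ss e p * Im (h $ j)))
        (2 * (duu e p h * Im (p $ j) + (1 + uu e p) * Im (h $ j))))"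

lemma grad_cosh2_has_derivative:
  assumes p: "p \<in> CH e"
  shows "(grad_cosh2 e has_derivative dgrad_cosh2 e p) (at p)"
proof -
  note d = uu_has_derivative[OF p] ss_has_derivative[OF p]
    bounded_linear_imp_has_derivative[OF bounded_linear_zpart]
    bounded_linear_imp_has_derivative[OF bounded_linear_tpart]
    bounded_linear_imp_has_derivative[OF bounded_linear_Im_nth]
  have "((\<lambda>q. grad_cosh2 e q $ j \<bullet> u) has_derivative (\<lambda>h. dgrad_cosh2 e p h $ j \<bullet> u)) (at p)" for j u
  proof (cases "j = e")
    case True
    have "((\<lambda>q. 2 * (1 + uu e q) * zpart e q) has_derivative
        (\<lambda>h. 2 * (duu e p h * zpart e p + (1 + uu e p) * zpart e h))) (at p)"
      by (auto intro!: derivative_eq_intros d simp: algebra_simps)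
    moreover have "((\<lambda>q. - 2 * tpart e q * ((1 + uu e q)\<^sup>2 + (ss e q)\<^sup>2 - 1 - uu e q)) has_derivative
        (\<lambda>h. - 2 * (tpart e h * ((1 + uu e p)\<^sup>2 + (ss e p)\<^sup>2 - 1 - uu e p)
                + tpart e p * (dcosh2 e p h - duu e p h)))) (at p)"
      unfolding dcosh2_def
      by (auto intro!: derivative_eq_intros d sum_of_squares_has_derivative simp: algebra_simps)
    ultimately show ?thesis
      using True unfolding grad_cosh2_def dgrad_cosh2_def inner_complex_def vec_lambda_beta
      by (simp only: simp_thms complex.sel if_True if_False) (intro has_derivative_add has_derivative_mult_left)
  next
    case False
    have "((\<lambda>q. - 2 * ss e q * Im (q $ j)) has_derivative
        (\<lambda>h. - 2 * (dss e p h * Im (p $ j) + ss e p * Im (h $ j)))) (at p)"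
      by (auto intro!: derivative_eq_intros d simp: algebra_simps)
    moreover have "((\<lambda>q. 2 * (1 + uu e q) * Im (q $ j)) has_derivative
        (\<lambda>h. 2 * (duu e p h * Im (p $ j) + (1 + uu e p) * Im (h $ j)))) (at p)"
      by (auto intro!: derivative_eq_intros d simp: algebra_simps)
    ultimately show ?thesis
      using False unfolding grad_cosh2_def dgrad_cosh2_def inner_complex_def vec_lambda_beta
      by (simp only: simp_thms complex.sel if_True if_False) (intro has_derivative_add has_derivative_mult_left)
  qed
  then show ?thesis
    unfolding has_derivative_componentwise_within[of "grad_cosh2 e"]
    by (auto simp: Basis_vec_def inner_axis)
qed

lemma sum_axis: "k \<noteq> e \<Longrightarrow> (\<Sum>j\<in>-{e}. c j * f (axis k u $ j)) = c k * f u"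
  if "f 0 = 0" for c :: "'k::finite \<Rightarrow> real" and f :: "complex \<Rightarrow> real"
  using that by (subst sum.mono_neutral_cong_right[of "-{e}" "{k}"]) (auto simp: axis_def)

lemma sum_axis_self: "(\<Sum>j\<in>-{e}. c j * f (axis e u $ j)) = 0"
  if "f 0 = 0" for c :: "'k::finite \<Rightarrow> real" and f :: "complex \<Rightarrow> real"
  using that by (intro sum.neutral) (auto simp: axis_def)

lemma laplace_cosh2_dist:
  fixes e :: "'k::finite"
  assumes p: "p \<in> CH e"
  shows "laplace_beltrami (CH_metric e) (cosh2_dist e) p
    = 2 * (real CARD('k) + 2) * cosh2_dist e p - 4"
proof -
  have t: "tpart e p > 0" using p by (simp add: CH_def)
  let ?g = "CH_metric e" and ?G = "riem_grad (CH_metric e) (cosh2_dist e)"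
  define D where "D = dgrad_cosh2 e p"
  have "(?G has_derivative D) (at p)"
    unfolding D_def
    by (rule has_derivative_transform_within_open[OF grad_cosh2_has_derivative[OF p] open_CH p])
      (simp add: riem_grad_cosh2_dist)
  then have fd: "frechet_derivative ?G (at p) = D" by (rule frechet_derivative_at[symmetric])
  have zt: "tpart e (axis j u) = (if j = e then Im u else 0)"
    "zpart e (axis j u) = (if j = e then Re u else 0)" for j u
    by (simp_all add: tpart_def zpart_def axis_def)
  have "(\<Sum>j\<in>-{e}. D (axis j 1) \<bullet> axis j 1 + D (axis j \<i>) \<bullet> axis j \<i>) =
      (\<Sum>j\<in>-{e}. 3 / tpart e p * (Im (p $ j))\<^sup>2 + 2 * (1 + uu e p))"
  proof (rule sum_Compl_cong)
    fix j assume j: "j \<noteq> e"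
    show "D (axis j 1) \<bullet> axis j 1 + D (axis j \<i>) \<bullet> axis j \<i> = 3 / tpart e p * (Im (p $ j))\<^sup>2 + 2 * (1 + uu e p)"
      using j t unfolding inner_axis
      by (simp add: D_def dgrad_cosh2_def inner_complex_def duu_def dss_def zt sum_axis sum_axis[of Re] sum_axis[of Im])
        (simp add: axis_def field_simps power2_eq_square)
  qed
  also have "\<dots> = 3 / tpart e p * imsq e p + 2 * (1 + uu e p) * (real CARD('k) - 1)"
    by (simp add: sum.distrib sum_distrib_left imsq_def Compl_eq_Diff_UNIV of_nat_diff Suc_leI algebra_simps)
  finally have 1: "(\<Sum>j\<in>-{e}. D (axis j 1) \<bullet> axis j 1 + D (axis j \<i>) \<bullet> axis j \<i>) =
    6 * uu e p + 2 * (1 + uu e p) * (real CARD('k) - 1)"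
    using t by (simp add: imsq_eq[OF p])
  have du: "duu e p (axis e 1) = 0" "duu e p (axis e \<i>) = - uu e p / tpart e p"
    and ds: "dss e p (axis e \<i>) = - ss e p / tpart e p"
    using t by (simp_all add: duu_def dss_def zt sum_axis_self[of Re] sum_axis_self[of Im])
  have 2: "D (axis e 1) \<bullet> axis e 1 = 2 * (1 + uu e p)"
    unfolding inner_axis by (simp add: D_def dgrad_cosh2_def inner_complex_def zt du)
  have 3: "D (axis e \<i>) \<bullet> axis e \<i> = 2 * cosh2_dist e p - 2 - 4 * uu e p"
    unfolding inner_axis cosh2_dist_eq[OF p] using t
    by (simp add: D_def dgrad_cosh2_def inner_complex_def zt du ds dcosh2_def)
      (simp add: field_simps power2_eq_square)
  have "(\<Sum>b\<in>Basis. D b \<bullet> b) = 6 * uu e p + 2 * (1 + uu e p) * (real CARD('k) - 1)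
      + 2 * (1 + uu e p) + (2 * cosh2_dist e p - 2 - 4 * uu e p)"
    unfolding sum_Basis_vec_complex sum_UNIV_split[where e = e] 1 2 3 by simp
  moreover have "(\<Sum>b\<in>Basis. christoffel ?g p b (grad_cosh2 e p) \<bullet> b) =
      2 * (real CARD('k) + 1) * (cosh2_dist e p - 1 - uu e p)"
    unfolding trace_christoffel_CH[OF p] grad_cosh2_nth cosh2_dist_eq[OF p]
    using t by (simp add: field_simps)
  ultimately show ?thesis
    unfolding laplace_beltrami_def riem_div_def cov_deriv_def fd riem_grad_cosh2_dist[OF p]
    by (simp add: inner_add_left sum.distrib algebra_simps)
qed

lemma isoparametric_cosh2_dist: "isoparametric (CH e) (CH_metric e) (cosh2_dist e)"
  unfolding isoparametric_def
proof (intro conjI exI)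
  show "smooth_on (CH e) (cosh2_dist e)" by (simp add: smooth_on_def Ck_on_cosh2_dist)
  show "\<forall>p\<in>CH e. laplace_beltrami (CH_metric e) (cosh2_dist e) p =
      (\<lambda>x. 2 * (real CARD('a) + 2) * x - 4) (cosh2_dist e p)"
    by (simp add: laplace_cosh2_dist)
  show "continuous_on (cosh2_dist e ` CH e) (\<lambda>x. 2 * (real CARD('a) + 2) * x - 4)"
    by (intro continuous_intros)
  show "\<forall>p\<in>CH e. CH_metric e p (riem_grad (CH_metric e) (cosh2_dist e) p)
      (riem_grad (CH_metric e) (cosh2_dist e) p) = (\<lambda>x. 4 * x * (x - 1)) (cosh2_dist e p)"
    by (simp add: riem_grad_cosh2_dist norm_grad_cosh2)
  show "C2_within (cosh2_dist e ` CH e) (\<lambda>x. 4 * x * (x - 1))"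
    unfolding C2_within_def
  proof (intro exI conjI ballI)
    show "((\<lambda>x. 4 * x * (x - 1)) has_real_derivative 8 * x - 4) (at x within S)" for x :: real and S
      by (auto intro!: derivative_eq_intros)
    show "((\<lambda>x. 8 * x - 4) has_real_derivative 8) (at x within S)" for x :: real and S
      by (auto intro!: derivative_eq_intros)
  qed (rule continuous_on_const)
qed

definition cosh2_numerator :: "'k \<Rightarrow> complex ^ 'k::finite \<Rightarrow> real" where
  "cosh2_numerator e p = (tpart e p + imsq e p / 2)\<^sup>2 + (zpart e p - reim e p / 2)\<^sup>2"

lemma cosh2_numerator_quartic: "polynomial_of_degree_le 4 (cosh2_numerator e)"
proof -
  have Re: "polynomial_of_degree_le 1 (\<lambda>p. Re (p $ j))" and Im: "polynomial_of_degree_le 1 (\<lambda>p. Im (p $ j))" for j :: 'a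
    using polynomial_of_degree_le_coordinate[of "axis j (1 :: complex)"] polynomial_of_degree_le_coordinate[of "axis j \<i>"]
    by (simp_all add: inner_axis inner_complex_def Basis_complex_def)
  have c: "polynomial_of_degree_le 2 (\<lambda>p. c * f p)" if "polynomial_of_degree_le 2 f" for c and f :: "complex ^ 'a \<Rightarrow> real"
    using polynomial_of_degree_le_mult[OF polynomial_of_degree_le_const[of c] that] by (simp only: add_0)
  have "polynomial_of_degree_le 2 (imsq e)" "polynomial_of_degree_le 2 (reim e)"
    unfolding imsq_def[abs_def] reim_def[abs_def]
    using polynomial_of_degree_le_power[OF Im, of 2] polynomial_of_degree_le_mult[OF Re Im]
    by (auto intro!: polynomial_of_degree_le_sum simp: numeral_2_eq_2)
  then have "polynomial_of_degree_le (2 * 2) (\<lambda>p. (tpart e p + (1/2) * imsq e p)\<^sup>2 + (zpart e p + (-1/2) * reim e p)\<^sup>2)"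
    unfolding tpart_def zpart_def
    by (intro polynomial_of_degree_le_add polynomial_of_degree_le_power c
        polynomial_of_degree_le_mono[OF Re] polynomial_of_degree_le_mono[OF Im]) auto
  then show ?thesis by (simp add: cosh2_numerator_def[abs_def])
qed

lemma cosh2_numerator_not_cubic:
  fixes e :: "'k::finite"
  assumes "CARD('k) \<ge> 2"
  shows "\<not> polynomial_of_degree_le 3 (cosh2_numerator e)"
proof
  assume "polynomial_of_degree_le 3 (cosh2_numerator e)"
  have "UNIV \<noteq> {e}"
  proof
    assume "UNIV = {e}"
    then have "CARD('k) = card {e}" by (rule arg_cong)
    then show False using assms by simp
  qed
  then obtain j where j: "j \<noteq> e" by blast
  obtain C where C: "\<And>r. r \<ge> 1 \<Longrightarrow> cosh2_numerator e (r *\<^sub>R axis j \<i>) \<le> C * r ^ 3"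
    using polynomial_of_degree_le_growth[OF \<open>polynomial_of_degree_le 3 (cosh2_numerator e)\<close>] by blast
  have "cosh2_numerator e (r *\<^sub>R axis j \<i>) = r ^ 4 / 4" for r
  proof -
    have "imsq e (r *\<^sub>R axis j \<i>) = r\<^sup>2"
      unfolding imsq_def using j
      by (subst sum.mono_neutral_cong_right[of "-{e}" "{j}"]) (auto simp: axis_def)
    moreover have "reim e (r *\<^sub>R axis j \<i>) = 0"
      unfolding reim_def by (intro sum.neutral) (auto simp: axis_def)
    ultimately show ?thesis
      using j by (simp add: cosh2_numerator_def tpart_def zpart_def axis_def power_divide flip: power_mult)
  qed
  with C[of "4 * \<bar>C\<bar> + 4"] have "(4 * \<bar>C\<bar> + 4) * (4 * \<bar>C\<bar> + 4) ^ 3 \<le> 4 * C * (4 * \<bar>C\<bar> + 4) ^ 3"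
    by (simp add: numeral_eq_Suc)
  then have "4 * \<bar>C\<bar> + 4 \<le> 4 * C"
    by (rule mult_right_le_imp_le) (auto intro!: zero_less_power)
  then show False by linarith
qed

section \<open>Distance from the real hyperbolic space: lower bound\<close>

lemma cosh2_dist_eq': "p \<in> CH e \<Longrightarrow> cosh2_dist e p = 1 + (uu e p * (2 + uu e p) + (ss e p)\<^sup>2)"
  by (simp add: cosh2_dist_eq power2_eq_square algebra_simps)

lemma cosh2_dist_ge_1: "p \<in> CH e \<Longrightarrow> cosh2_dist e p \<ge> 1"
  by (simp add: cosh2_dist_eq' uu_nonneg)

lemma imsq_eq_0_iff: "imsq e p = 0 \<longleftrightarrow> (\<forall>j\<in>-{e}. Im (p $ j) = 0)"
  by (simp add: imsq_def sum_nonneg_eq_0_iff)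

lemma reim_eq_0: "imsq e p = 0 \<Longrightarrow> reim e p = 0"
  by (simp add: imsq_eq_0_iff reim_def)

lemma RH_iff: "p \<in> RH e \<longleftrightarrow> p \<in> CH e \<and> imsq e p = 0 \<and> zpart e p = 0"
  unfolding RH_def by (simp flip: norm_Im_vec)

lemma cosh2_dist_eq_1_iff:
  assumes p: "p \<in> CH e"
  shows "cosh2_dist e p = 1 \<longleftrightarrow> p \<in> RH e"
proof -
  have t: "tpart e p > 0" using p by (simp add: CH_def)
  have "uu e p * (2 + uu e p) \<ge> 0" using uu_nonneg[OF p] by simp
  then have "cosh2_dist e p = 1 \<longleftrightarrow> uu e p * (2 + uu e p) = 0 \<and> (ss e p)\<^sup>2 = 0"
    unfolding cosh2_dist_eq'[OF p] by (smt (verit) zero_le_power2)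
  also have "\<dots> \<longleftrightarrow> imsq e p = 0 \<and> zpart e p = 0"
    using uu_nonneg[OF p] t reim_eq_0[of e p] by (auto simp: uu_def ss_def)
  finally show ?thesis using p by (simp add: RH_iff)
qed

lemma sqrt_CH_metric: "p \<in> CH e \<Longrightarrow> sqrt (CH_metric e p X X) = norm (coframe e p X)"
  by (simp add: coframed_metric.metric_eq[OF coframed_metric_CH] norm_eq_sqrt_inner)

lemma speed_CH_nonneg: "\<gamma> s \<in> CH e \<Longrightarrow> speed (CH_metric e) \<gamma> s \<ge> 0"
  by (simp add: speed_def sqrt_CH_metric)

lemma abs_dcosh2_le:
  assumes p: "p \<in> CH e"
  shows "\<bar>dcosh2 e p W\<bar> \<le> sqrt (4 * cosh2_dist e p * (cosh2_dist e p - 1)) * sqrt (CH_metric e p W W)"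
proof -
  have "dcosh2 e p W = coframe e p (grad_cosh2 e p) \<bullet> coframe e p W"
    by (simp add: metric_grad_cosh2[OF p, symmetric] coframed_metric.metric_eq[OF coframed_metric_CH[OF p]])
  then show ?thesis
    by (simp add: norm_grad_cosh2[OF p, symmetric] sqrt_CH_metric[OF p] Cauchy_Schwarz_ineq2)
qed

text \<open>Half of \<open>arcosh (2 F - 1)\<close> is \<open>arcosh (sqrt F)\<close>, the candidate for the distance; it is not
  differentiable where \<open>F = 1\<close>, hence the perturbation by \<open>\<delta>\<close>.\<close>

lemma arcosh_cosh2_dist_diff_le_length:
  assumes \<gamma>: "valid_path \<gamma>" "path_image \<gamma> \<subseteq> CH e"
    and int: "speed (CH_metric e) \<gamma> integrable_on {0..1}" and \<delta>: "\<delta> > 0"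
  shows "arcosh (2 * cosh2_dist e (pathstart \<gamma>) - 1 + \<delta>) / 2
       - arcosh (2 * cosh2_dist e (pathfinish \<gamma>) - 1 + \<delta>) / 2
    \<le> integral {0..1} (speed (CH_metric e) \<gamma>)"
proof -
  obtain S where S: "finite S" "\<gamma> C1_differentiable_on ({0..1} - S)" and cont: "continuous_on {0..1} \<gamma>"
    using \<gamma>(1) unfolding valid_path_def piecewise_C1_differentiable_on_def by blast
  have in_CH: "\<gamma> s \<in> CH e" if "s \<in> {0..1}" for s
    using \<gamma>(2) that by (auto simp: path_image_def)
  define a where "a s = 2 * cosh2_dist e (\<gamma> s) - 1 + \<delta>" for s
  define f where "f s = arcosh (a s) / 2" for s
  define f' where "f' s = (if s \<in> {0<..<1} - S
      then dcosh2 e (\<gamma> s) (vector_derivative \<gamma> (at s)) / sqrt ((a s)\<^sup>2 - 1) else 0)" for s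
  have a: "a s > 1" if "s \<in> {0..1}" for s
    using cosh2_dist_ge_1[OF in_CH[OF that]] \<delta> by (simp add: a_def)
  have contF: "continuous_on {0..1} (\<lambda>s. cosh2_dist e (\<gamma> s))"
    by (rule continuous_on_compose2[OF _ cont, of "CH e"])
      (use Ck_on_cosh2_dist[of 0 e] in_CH in auto)
  have contf: "continuous_on {0..1} f"
    unfolding f_def
    by (intro continuous_on_divide continuous_on_const continuous_on_arcosh')
      (use a contF in \<open>auto simp: a_def less_imp_le intro!: continuous_intros\<close>)
  have der: "(f has_vector_derivative f' s) (at s)" if s: "s \<in> {0<..<1} - S" for s
  proof -
    have s01: "s \<in> {0..1}" using s by auto
    have "\<gamma> differentiable at s" using S(2) s by (auto simp: C1_differentiable_on_eq)
    then have "(\<gamma> has_vector_derivative vector_derivative \<gamma> (at s)) (at s)"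
      by (simp add: vector_derivative_works)
    then have "((\<lambda>s. cosh2_dist e (\<gamma> s)) has_derivative
        (\<lambda>h. dcosh2 e (\<gamma> s) (h *\<^sub>R vector_derivative \<gamma> (at s)))) (at s)"
      unfolding has_vector_derivative_def
      by (rule has_derivative_compose) (rule cosh2_dist_has_derivative[OF in_CH[OF s01]])
    then have "((\<lambda>s. cosh2_dist e (\<gamma> s)) has_real_derivative
        dcosh2 e (\<gamma> s) (vector_derivative \<gamma> (at s))) (at s)"
      by (rule has_derivative_imp_has_field_derivative)
        (simp add: linear_scale[OF has_derivative_linear[OF cosh2_dist_has_derivative[OF in_CH[OF s01]]]])
    then have "(a has_real_derivative 2 * dcosh2 e (\<gamma> s) (vector_derivative \<gamma> (at s))) (at s)"
      unfolding a_def by (auto intro!: derivative_eq_intros)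
    from DERIV_chain2[OF arcosh_real_has_field_derivative[OF a[OF s01]] this]
    have "(f has_real_derivative f' s) (at s)"
      unfolding f_def using s by (auto intro!: derivative_eq_intros simp: f'_def)
    then show ?thesis by (simp add: has_real_derivative_iff_has_vector_derivative)
  qed
  have "(f' has_integral (f 1 - f 0)) {0..1}"
    by (rule fundamental_theorem_of_calculus_interior_strong[OF S(1) _ der contf]) auto
  from has_integral_neg[OF this] have "((\<lambda>s. - f' s) has_integral (f 0 - f 1)) {0..1}"
    by simp
  moreover have "- f' s \<le> speed (CH_metric e) \<gamma> s" if s: "s \<in> {0..1}" for s
  proof (cases "s \<in> {0<..<1} - S")
    case True
    let ?F = "cosh2_dist e (\<gamma> s)" and ?V = "vector_derivative \<gamma> (at s)"
    have "4 * ?F * (?F - 1) = (2 * ?F - 1)\<^sup>2 - 1" by (simp add: power2_eq_square algebra_simps)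
    also have "\<dots> \<le> (a s)\<^sup>2 - 1"
      using cosh2_dist_ge_1[OF in_CH[OF s]] \<delta> by (simp add: a_def power_mono)
    finally have le: "sqrt (4 * ?F * (?F - 1)) \<le> sqrt ((a s)\<^sup>2 - 1)" by simp
    have pos: "sqrt ((a s)\<^sup>2 - 1) > 0" using a[OF s] by (simp add: power_strict_mono one_less_power)
    have "\<bar>dcosh2 e (\<gamma> s) ?V\<bar> \<le> sqrt (4 * ?F * (?F - 1)) * speed (CH_metric e) \<gamma> s"
      unfolding speed_def by (rule abs_dcosh2_le[OF in_CH[OF s]])
    also have "\<dots> \<le> sqrt ((a s)\<^sup>2 - 1) * speed (CH_metric e) \<gamma> s"
      by (intro mult_right_mono le speed_CH_nonneg in_CH s)
    finally have "- dcosh2 e (\<gamma> s) ?V \<le> speed (CH_metric e) \<gamma> s * sqrt ((a s)\<^sup>2 - 1)"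
      by (simp add: mult.commute)
    then have "- dcosh2 e (\<gamma> s) ?V / sqrt ((a s)\<^sup>2 - 1) \<le> speed (CH_metric e) \<gamma> s"
      using pos by (simp only: pos_divide_le_eq)
    then show ?thesis using True by (simp add: f'_def)
  next
    case False
    then show ?thesis using speed_CH_nonneg[of \<gamma> s e, OF in_CH[OF s]] by (auto simp: f'_def)
  qed
  ultimately have "f 0 - f 1 \<le> integral {0..1} (speed (CH_metric e) \<gamma>)"
    using has_integral_le[OF _ integrable_integral[OF int]] by blast
  then show ?thesis by (simp add: f_def a_def pathstart_def pathfinish_def)
qed

lemma arcosh_cosh2_dist_le_length:
  assumes \<gamma>: "valid_path \<gamma>" "path_image \<gamma> \<subseteq> CH e" "pathfinish \<gamma> \<in> RH e"
    and int: "speed (CH_metric e) \<gamma> integrable_on {0..1}"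
  shows "arcosh (2 * cosh2_dist e (pathstart \<gamma>) - 1) / 2 \<le> integral {0..1} (speed (CH_metric e) \<gamma>)"
proof (rule field_le_epsilon)
  fix \<epsilon> :: real assume \<epsilon>: "\<epsilon> > 0"
  define \<delta> where "\<delta> = cosh (2 * \<epsilon>) - 1"
  have \<delta>: "\<delta> > 0" using \<epsilon> cosh_real_strict_mono[of 0 "2 * \<epsilon>"] by (simp add: \<delta>_def)
  have start: "pathstart \<gamma> \<in> CH e" using \<gamma>(2) by auto
  have finish: "cosh2_dist e (pathfinish \<gamma>) = 1"
    using \<gamma>(3) cosh2_dist_eq_1_iff[of "pathfinish \<gamma>" e] by (simp add: RH_iff)
  have "arcosh (2 * cosh2_dist e (pathstart \<gamma>) - 1) \<le> arcosh (2 * cosh2_dist e (pathstart \<gamma>) - 1 + \<delta>)"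
    using cosh2_dist_ge_1[OF start] \<delta> by (intro arcosh_real_strict_mono[THEN less_imp_le]) auto
  moreover have "arcosh (2 * cosh2_dist e (pathfinish \<gamma>) - 1 + \<delta>) = 2 * \<epsilon>"
    using \<epsilon> by (simp add: finish \<delta>_def arcosh_cosh_real)
  ultimately show "arcosh (2 * cosh2_dist e (pathstart \<gamma>) - 1) / 2
      \<le> integral {0..1} (speed (CH_metric e) \<gamma>) + \<epsilon>"
    using arcosh_cosh2_dist_diff_le_length[OF \<gamma>(1,2) int \<delta>] by simp
qed

lemma convex_CH: "convex (CH e)"
proof -
  have "CH e = {p. axis e \<i> \<bullet> p > 0}"
    by (simp add: CH_def tpart_def inner_commute[of "axis e \<i>"] inner_axis inner_complex_def)
  then show ?thesis by (simp add: convex_halfspace_gt)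
qed

lemma linepath_finite_length:
  assumes "p \<in> CH e" "q \<in> CH e"
  shows "path_image (linepath p q) \<subseteq> CH e" "speed (CH_metric e) (linepath p q) integrable_on {0..1}"
proof -
  show sub: "path_image (linepath p q) \<subseteq> CH e"
    using assms by (simp add: closed_segment_subset convex_CH)
  have c: "continuous_on (CH e) (\<lambda>x. CH_metric e x X X)" for X
    by (intro continuous_at_imp_continuous_on ballI has_derivative_continuous[OF CH_metric_has_derivative])
  have "continuous_on {0..1} (\<lambda>s. sqrt (CH_metric e (linepath p q s) (q - p) (q - p)))"
    by (intro continuous_on_real_sqrt continuous_on_compose2[OF c] continuous_on_linepath)
      (use sub in \<open>auto simp: path_image_def\<close>)
  then show "speed (CH_metric e) (linepath p q) integrable_on {0..1}"
    by (auto intro: integrable_continuous_real simp: speed_def[abs_def])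
qed

lemma length_CH_nonneg:
  assumes "path_image \<gamma> \<subseteq> CH e" "speed (CH_metric e) \<gamma> integrable_on {0..1}"
  shows "integral {0..1} (speed (CH_metric e) \<gamma>) \<ge> 0"
  using assms
  by (intro Henstock_Kurzweil_Integration.integral_nonneg speed_CH_nonneg) (auto simp: path_image_def)

lemma riem_dist_CH_le:
  assumes "valid_path \<gamma>" "path_image \<gamma> \<subseteq> CH e" "speed (CH_metric e) \<gamma> integrable_on {0..1}"
  shows "riem_dist (CH e) (CH_metric e) (pathstart \<gamma>) (pathfinish \<gamma>)
    \<le> integral {0..1} (speed (CH_metric e) \<gamma>)"
  unfolding riem_dist_def
  by (rule cInf_lower) (use assms in \<open>auto intro!: bdd_belowI[of _ 0] length_CH_nonneg\<close>)

lemma le_riem_dist_CH: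
  assumes "p \<in> CH e" "q \<in> CH e"
    and le: "\<And>\<gamma>. valid_path \<gamma> \<Longrightarrow> path_image \<gamma> \<subseteq> CH e \<Longrightarrow> pathstart \<gamma> = p \<Longrightarrow> pathfinish \<gamma> = q \<Longrightarrow>
      speed (CH_metric e) \<gamma> integrable_on {0..1} \<Longrightarrow> c \<le> integral {0..1} (speed (CH_metric e) \<gamma>)"
  shows "c \<le> riem_dist (CH e) (CH_metric e) p q"
  unfolding riem_dist_def
proof (rule cInf_greatest)
  show "{integral {0..1} (speed (CH_metric e) \<gamma>) |\<gamma>. valid_path \<gamma> \<and> path_image \<gamma> \<subseteq> CH e \<and>
      pathstart \<gamma> = p \<and> pathfinish \<gamma> = q \<and> speed (CH_metric e) \<gamma> integrable_on {0..1}} \<noteq> {}"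
    using linepath_finite_length[OF assms(1,2)] valid_path_linepath[of p q] by force
qed (use le in blast)

lemma riem_dist_CH_nonneg:
  "p \<in> CH e \<Longrightarrow> q \<in> CH e \<Longrightarrow> 0 \<le> riem_dist (CH e) (CH_metric e) p q"
  by (rule le_riem_dist_CH) (auto intro: length_CH_nonneg)

lemma RH_subset_CH: "RH e \<subseteq> CH e"
  by (auto simp: RH_iff)

lemma axis_in_RH: "axis e \<i> \<in> RH e"
  by (auto simp: RH_iff imsq_eq_0_iff CH_def tpart_def zpart_def axis_def)

lemma arcosh_le_riem_infdist:
  assumes p: "p \<in> CH e"
  shows "arcosh (2 * cosh2_dist e p - 1) / 2 \<le> riem_infdist (CH e) (CH_metric e) p (RH e)"
  unfolding riem_infdist_def
proof (rule cINF_greatest)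
  show "RH e \<noteq> {}" using axis_in_RH by blast
  show "arcosh (2 * cosh2_dist e p - 1) / 2 \<le> riem_dist (CH e) (CH_metric e) p q" if "q \<in> RH e" for q
    using p that RH_subset_CH arcosh_cosh2_dist_le_length by (intro le_riem_dist_CH) blast+
qed

lemma riem_infdist_RH_le_length:
  assumes "valid_path \<gamma>" "path_image \<gamma> \<subseteq> CH e" "speed (CH_metric e) \<gamma> integrable_on {0..1}"
    and "pathfinish \<gamma> \<in> RH e"
  shows "riem_infdist (CH e) (CH_metric e) (pathstart \<gamma>) (RH e)
    \<le> integral {0..1} (speed (CH_metric e) \<gamma>)"
  unfolding riem_infdist_def
proof (rule cINF_lower2)
  have "pathstart \<gamma> \<in> CH e" using assms(2) by auto
  then show "bdd_below (riem_dist (CH e) (CH_metric e) (pathstart \<gamma>) ` RH e)"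
    using RH_subset_CH by (auto intro!: bdd_belowI[of _ 0] riem_dist_CH_nonneg)
  show "pathfinish \<gamma> \<in> RH e" by fact
  show "riem_dist (CH e) (CH_metric e) (pathstart \<gamma>) (pathfinish \<gamma>)
      \<le> integral {0..1} (speed (CH_metric e) \<gamma>)"
    using assms(1-3) by (rule riem_dist_CH_le)
qed

section \<open>The geodesic to the real hyperbolic space\<close>

text \<open>The geodesic from \<open>p = (x + i y, z, t)\<close> orthogonal to the real hyperbolic space runs through points
  \<open>(x + \<xi> y + i \<eta> y, \<sigma>, \<tau>)\<close>; \<open>\<omega>\<close> is \<open>\<sigma>\<close> minus half the inner product of real and imaginary part.\<close>

definition slice_point :: "'k \<Rightarrow> complex ^ 'k::finite \<Rightarrow> real \<Rightarrow> real \<Rightarrow> real \<Rightarrow> real \<Rightarrow> complex ^ 'k" where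
  "slice_point e p \<xi> \<eta> \<omega> \<tau> = (\<chi> j. if j = e then Complex (\<omega> + \<eta> * (reim e p + \<xi> * imsq e p) / 2) \<tau>
     else Complex (Re (p $ j) + \<xi> * Im (p $ j)) (\<eta> * Im (p $ j)))"

definition slice_velocity ::
  "'k \<Rightarrow> complex ^ 'k::finite \<Rightarrow> real \<Rightarrow> real \<Rightarrow> real \<Rightarrow> real \<Rightarrow> real \<Rightarrow> real \<Rightarrow> complex ^ 'k" where
  "slice_velocity e p \<xi> \<eta> \<xi>' \<eta>' \<omega>' \<tau>' = (\<chi> j. if j = e
     then Complex (\<omega>' + (\<eta>' * (reim e p + \<xi> * imsq e p) + \<eta> * (\<xi>' * imsq e p)) / 2) \<tau>'
     else Complex (\<xi>' * Im (p $ j)) (\<eta>' * Im (p $ j)))"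

lemma CH_metric_scale: "CH_metric e q (c *\<^sub>R X) (c *\<^sub>R X) = c\<^sup>2 * CH_metric e q X X"
  by (simp add: CH_metric_eq linear_scale[OF linear_contact] linear_scale[OF linear_tpart]
      sum_distrib_left power2_eq_square distrib_left mult_ac)

lemma slice_point_self:
  "slice_point e p 0 1 (zpart e p - reim e p / 2) (tpart e p) = p"
  by (simp add: slice_point_def vec_eq_iff zpart_def tpart_def complex_eq_iff)

lemma tpart_slice_point: "tpart e (slice_point e p \<xi> \<eta> \<omega> \<tau>) = \<tau>"
  by (simp add: slice_point_def tpart_def)

lemma slice_point_in_RH: "\<tau> > 0 \<Longrightarrow> slice_point e p \<xi> 0 0 \<tau> \<in> RH e"
  by (simp add: RH_iff CH_def tpart_slice_point) (simp add: slice_point_def zpart_def imsq_def)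

lemma has_vector_derivative_vecI:
  fixes f :: "real \<Rightarrow> complex ^ 'k::finite"
  assumes "\<And>j. ((\<lambda>s. f s $ j) has_vector_derivative f' $ j) (at s)"
  shows "(f has_vector_derivative f') (at s)"
  unfolding has_vector_derivative_def has_derivative_componentwise_within[of f]
proof
  fix b :: "complex ^ 'k" assume "b \<in> Basis"
  then obtain j u where b: "b = axis j u" by (auto simp: Basis_vec_def)
  show "((\<lambda>s. f s \<bullet> b) has_derivative (\<lambda>h. (h *\<^sub>R f') \<bullet> b)) (at s)"
    using has_derivative_inner_left[OF assms[of j, unfolded has_vector_derivative_def], of u]
    by (simp add: b inner_axis)
qed

lemma slice_point_has_vector_derivative:
  assumes [derivative_intros]: "(\<xi> has_real_derivative \<xi>') (at s)" "(\<eta> has_real_derivative \<eta>') (at s)"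
    "(\<omega> has_real_derivative \<omega>') (at s)" "(\<tau> has_real_derivative \<tau>') (at s)"
  shows "((\<lambda>s. slice_point e p (\<xi> s) (\<eta> s) (\<omega> s) (\<tau> s)) has_vector_derivative
    slice_velocity e p (\<xi> s) (\<eta> s) \<xi>' \<eta>' \<omega>' \<tau>') (at s)"
proof (rule has_vector_derivative_vecI)
  fix j
  show "((\<lambda>s. slice_point e p (\<xi> s) (\<eta> s) (\<omega> s) (\<tau> s) $ j) has_vector_derivative
      slice_velocity e p (\<xi> s) (\<eta> s) \<xi>' \<eta>' \<omega>' \<tau>' $ j) (at s)"
    by (cases "j = e")
      (auto simp: has_vector_derivative_complex_iff slice_point_def slice_velocity_def algebra_simps
        intro!: derivative_eq_intros)
qed

lemma metric_slice_velocity: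
  assumes "\<tau> \<noteq> 0"
  shows "CH_metric e (slice_point e p \<xi> \<eta> \<omega> \<tau>) (slice_velocity e p \<xi> \<eta> \<xi>' \<eta>' \<omega>' \<tau>')
      (slice_velocity e p \<xi> \<eta> \<xi>' \<eta>' \<omega>' \<tau>')
    = (\<xi>'\<^sup>2 + \<eta>'\<^sup>2) * imsq e p / \<tau> + ((\<omega>' + \<eta> * \<xi>' * imsq e p) / \<tau>)\<^sup>2 + (\<tau>' / \<tau>)\<^sup>2"
proof -
  let ?q = "slice_point e p \<xi> \<eta> \<omega> \<tau>" and ?V = "slice_velocity e p \<xi> \<eta> \<xi>' \<eta>' \<omega>' \<tau>'"
  have 1: "(\<Sum>j\<in>-{e}. ?V $ j \<bullet> ?V $ j) = (\<xi>'\<^sup>2 + \<eta>'\<^sup>2) * imsq e p"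
    unfolding imsq_def sum_distrib_left
    by (rule sum_Compl_cong) (simp add: slice_velocity_def inner_complex_def power2_eq_square algebra_simps)
  have "sympl e ?V ?q = \<xi>' * \<eta> * imsq e p - \<eta>' * (reim e p + \<xi> * imsq e p)"
    unfolding sympl_def imsq_def reim_def sum_distrib_left sum_subtractf[symmetric] sum.distrib[symmetric]
    by (rule sum_Compl_cong)
      (simp add: slice_velocity_def slice_point_def power2_eq_square algebra_simps)
  then have 2: "contact e ?q ?V = \<omega>' + \<eta> * \<xi>' * imsq e p"
    by (simp add: contact_def zpart_def slice_velocity_def algebra_simps add_divide_distrib diff_divide_distrib)
  have 3: "tpart e ?V = \<tau>'" by (simp add: tpart_def slice_velocity_def)
  show ?thesis
    unfolding CH_metric_eq 1 2 3 tpart_slice_point by (simp add: power2_eq_square)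
qed

text \<open>Here \<open>C\<close>, \<open>S\<close> stand for \<open>cosh \<rho>\<close>, \<open>sinh \<rho>\<close> at arc length \<open>\<rho>\<close>.\<close>

lemma unit_speed_identity:
  fixes A B C D K N S T \<sigma> :: real
  assumes D: "D = A * C + B" "D > 0" and T: "T > 0" and C: "C\<^sup>2 = S\<^sup>2 + 1"
    and A: "A\<^sup>2 = B\<^sup>2 + \<sigma>\<^sup>2" and N: "K\<^sup>2 * N = 2 * T * B"
  shows "((- \<sigma> * K * S / D\<^sup>2)\<^sup>2 + (K * (A + B * C) / D\<^sup>2)\<^sup>2) * N / (T / D)
    + ((\<sigma> * T * ((C\<^sup>2 + S\<^sup>2) * D - 2 * A * S\<^sup>2 * C) / D ^ 3 + (K * S / D) * (- \<sigma> * K * S / D\<^sup>2) * N) / (T / D))\<^sup>2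
    + ((- T * A * S / D\<^sup>2) / (T / D))\<^sup>2 = 1"
proof -
  have ne: "D \<noteq> 0" "T \<noteq> 0" using D(2) T by simp_all
  have "((- \<sigma> * K * S / D\<^sup>2)\<^sup>2 + (K * (A + B * C) / D\<^sup>2)\<^sup>2) * N / (T / D)
      = (K\<^sup>2 * N) * (\<sigma>\<^sup>2 * S\<^sup>2 + (A + B * C)\<^sup>2) / (T * D ^ 3)"
    using ne by (simp add: field_simps power2_eq_square power3_eq_cube)
  also have "\<sigma>\<^sup>2 * S\<^sup>2 + (A + B * C)\<^sup>2 = D\<^sup>2"
  proof -
    have "\<sigma>\<^sup>2 * S\<^sup>2 = (A\<^sup>2 - B\<^sup>2) * (C\<^sup>2 - 1)" using A C by simp
    then show ?thesis unfolding D(1) by (simp add: power2_eq_square algebra_simps)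
  qed
  also have "(K\<^sup>2 * N) * D\<^sup>2 / (T * D ^ 3) = 2 * B / D"
    unfolding N using ne by (simp add: field_simps power2_eq_square power3_eq_cube)
  finally have 1: "((- \<sigma> * K * S / D\<^sup>2)\<^sup>2 + (K * (A + B * C) / D\<^sup>2)\<^sup>2) * N / (T / D) = 2 * B / D" .
  have "(\<sigma> * T * ((C\<^sup>2 + S\<^sup>2) * D - 2 * A * S\<^sup>2 * C) / D ^ 3 + (K * S / D) * (- \<sigma> * K * S / D\<^sup>2) * N) / (T / D)
      = \<sigma> * (T * ((C\<^sup>2 + S\<^sup>2) * D - 2 * A * S\<^sup>2 * C) - (K\<^sup>2 * N) * S\<^sup>2) / (T * D\<^sup>2)"
    using ne by (simp add: field_simps power2_eq_square power3_eq_cube)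
  also have "T * ((C\<^sup>2 + S\<^sup>2) * D - 2 * A * S\<^sup>2 * C) - (K\<^sup>2 * N) * S\<^sup>2 = T * D"
    unfolding N D(1) C by (simp add: algebra_simps)
  also have "\<sigma> * (T * D) / (T * D\<^sup>2) = \<sigma> / D"
    using ne by (simp add: power2_eq_square)
  finally have 2: "(\<sigma> * T * ((C\<^sup>2 + S\<^sup>2) * D - 2 * A * S\<^sup>2 * C) / D ^ 3
      + (K * S / D) * (- \<sigma> * K * S / D\<^sup>2) * N) / (T / D) = \<sigma> / D" .
  have 3: "(- T * A * S / D\<^sup>2) / (T / D) = - A * S / D"
    using ne by (simp add: power2_eq_square)
  have "2 * B * D + \<sigma>\<^sup>2 + A\<^sup>2 * S\<^sup>2 = D\<^sup>2"
  proof -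
    have eqs: "\<sigma>\<^sup>2 = A\<^sup>2 - B\<^sup>2" "S\<^sup>2 = C\<^sup>2 - 1" using A C by simp_all
    show ?thesis unfolding eqs D(1) by (simp add: power2_eq_square algebra_simps)
  qed
  then show ?thesis
    unfolding 1 2 3 using ne by (simp add: field_simps power2_eq_square)
qed

lemma exists_geodesic_to_RH:
  assumes p: "p \<in> CH e" and F: "cosh2_dist e p > 1" and r: "cosh2_dist e p = (cosh r)\<^sup>2" "r \<ge> 0"
  shows "\<exists>\<gamma>. valid_path \<gamma> \<and> path_image \<gamma> \<subseteq> CH e \<and> pathstart \<gamma> = p \<and> pathfinish \<gamma> \<in> RH e
    \<and> (\<forall>s. speed (CH_metric e) \<gamma> s = r)"
proof -
  have t: "tpart e p > 0" using p by (simp add: CH_def)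
  define C1 K B A \<sigma> T where "C1 = cosh r" and "K = sinh r" and "B = uu e p"
    and "A = C1 - (1 + uu e p) / C1" and "\<sigma> = K * ss e p / C1" and "T = tpart e p * K\<^sup>2"
  have C1: "C1 > 0" and K: "K\<^sup>2 = C1\<^sup>2 - 1"
    by (simp_all add: C1_def K_def cosh_real_pos sinh_square_eq)
  have FC: "C1\<^sup>2 = (1 + B)\<^sup>2 + (ss e p)\<^sup>2"
    using r(1) by (simp add: C1_def B_def cosh2_dist_eq[OF p])
  have K0: "K > 0"
  proof -
    have "K\<^sup>2 > 0" using F r(1) K by (simp add: C1_def)
    moreover have "K \<ge> 0" using r(2) by (simp add: K_def)
    ultimately show ?thesis by (metis less_eq_real_def zero_power2 less_irrefl)
  qed
  have B: "B \<ge> 0" by (simp add: B_def uu_nonneg[OF p])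
  have AC1: "A * C1 = C1\<^sup>2 - 1 - B"
    using C1 by (simp add: A_def B_def field_simps power2_eq_square)
  have "C1\<^sup>2 - 1 - B > 0"
  proof (cases "B = 0")
    case True
    then show ?thesis using K K0 zero_less_power[OF K0, of 2] by simp
  next
    case False
    have "C1\<^sup>2 - 1 - B = B + B\<^sup>2 + (ss e p)\<^sup>2" unfolding FC by (simp add: power2_eq_square algebra_simps)
    then show ?thesis using B False by (simp add: add_pos_nonneg)
  qed
  then have A: "A > 0" using AC1 C1 by (metis zero_less_mult_pos2)
  have A2: "A\<^sup>2 = B\<^sup>2 + \<sigma>\<^sup>2"
  proof -
    have s2: "(ss e p)\<^sup>2 = C1\<^sup>2 - (1 + B)\<^sup>2" using FC by simp
    have "(A * C1)\<^sup>2 = (B\<^sup>2 + \<sigma>\<^sup>2) * C1\<^sup>2"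
    proof -
      have "(B\<^sup>2 + \<sigma>\<^sup>2) * C1\<^sup>2 = B\<^sup>2 * C1\<^sup>2 + K\<^sup>2 * (ss e p)\<^sup>2"
        using C1 by (simp add: \<sigma>_def field_simps)
      then show ?thesis unfolding AC1 s2 K by (simp add: power2_eq_square algebra_simps)
    qed
    then show ?thesis using C1 by (simp add: power_mult_distrib)
  qed
  have T: "T > 0" using t K0 by (simp add: T_def)
  have N: "K\<^sup>2 * imsq e p = 2 * T * B" by (simp add: T_def B_def imsq_eq[OF p])
  define D where "D \<rho> = A * cosh \<rho> + B" for \<rho>
  have D: "D \<rho> > 0" for \<rho>
    using A B by (simp add: D_def add_pos_nonneg cosh_real_pos)
  have D': "(D has_real_derivative A * sinh \<rho>) (at \<rho>)" for \<rho>
    unfolding D_def by (auto intro!: derivative_eq_intros)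
  define \<xi> where "\<xi> \<rho> = (\<sigma> * K / A) * (1 / D \<rho> - 1 / K\<^sup>2)" for \<rho>
  define \<eta> where "\<eta> \<rho> = K * sinh \<rho> / D \<rho>" for \<rho>
  define \<omega> where "\<omega> \<rho> = \<sigma> * T * sinh \<rho> * cosh \<rho> / (D \<rho>)\<^sup>2" for \<rho>
  define \<tau> where "\<tau> \<rho> = T / D \<rho>" for \<rho>
  define \<xi>' where "\<xi>' \<rho> = - \<sigma> * K * sinh \<rho> / (D \<rho>)\<^sup>2" for \<rho>
  define \<eta>' where "\<eta>' \<rho> = K * (A + B * cosh \<rho>) / (D \<rho>)\<^sup>2" for \<rho>
  define \<omega>' where "\<omega>' \<rho> = \<sigma> * T * (((cosh \<rho>)\<^sup>2 + (sinh \<rho>)\<^sup>2) * D \<rho> - 2 * A * (sinh \<rho>)\<^sup>2 * cosh \<rho>) / (D \<rho>) ^ 3" for \<rho>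
  define \<tau>' where "\<tau>' \<rho> = - T * A * sinh \<rho> / (D \<rho>)\<^sup>2" for \<rho>
  have Dne: "D \<rho> \<noteq> 0" for \<rho> using D[of \<rho>] by simp
  have d\<xi>: "(\<xi> has_real_derivative \<xi>' \<rho>) (at \<rho>)" for \<rho>
    unfolding \<xi>_def \<xi>'_def using A Dne[of \<rho>]
    by (auto intro!: derivative_eq_intros D' simp: field_simps power2_eq_square)
  have d\<eta>: "(\<eta> has_real_derivative \<eta>' \<rho>) (at \<rho>)" for \<rho>
  proof -
    have "(\<eta> has_real_derivative (K * cosh \<rho> * D \<rho> - K * sinh \<rho> * (A * sinh \<rho>)) / (D \<rho> * D \<rho>)) (at \<rho>)"
      unfolding \<eta>_def using Dne[of \<rho>] by (auto intro!: derivative_eq_intros D')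
    moreover have "K * cosh \<rho> * D \<rho> - K * sinh \<rho> * (A * sinh \<rho>) = K * (A * ((cosh \<rho>)\<^sup>2 - (sinh \<rho>)\<^sup>2) + B * cosh \<rho>)"
      by (simp add: D_def power2_eq_square algebra_simps)
    ultimately show ?thesis by (simp only: \<eta>'_def power2_eq_square[of "D \<rho>"] hyperbolic_pythagoras mult_1_right)
  qed
  have d\<omega>: "(\<omega> has_real_derivative \<omega>' \<rho>) (at \<rho>)" for \<rho>
    unfolding \<omega>_def \<omega>'_def using Dne[of \<rho>]
    by (auto intro!: derivative_eq_intros D' simp: field_simps power2_eq_square power3_eq_cube)
  have d\<tau>: "(\<tau> has_real_derivative \<tau>' \<rho>) (at \<rho>)" for \<rho>
    unfolding \<tau>_def \<tau>'_def using Dne[of \<rho>]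
    by (auto intro!: derivative_eq_intros D' simp: field_simps power2_eq_square)
  define c where "c \<rho> = slice_point e p (\<xi> \<rho>) (\<eta> \<rho>) (\<omega> \<rho>) (\<tau> \<rho>)" for \<rho>
  define v where "v \<rho> = slice_velocity e p (\<xi> \<rho>) (\<eta> \<rho>) (\<xi>' \<rho>) (\<eta>' \<rho>) (\<omega>' \<rho>) (\<tau>' \<rho>)" for \<rho>
  have cv: "(c has_vector_derivative v \<rho>) (at \<rho>)" for \<rho>
    unfolding c_def v_def by (rule slice_point_has_vector_derivative[OF d\<xi> d\<eta> d\<omega> d\<tau>])
  have unit: "CH_metric e (c \<rho>) (v \<rho>) (v \<rho>) = 1" for \<rho>
  proof -
    have "\<tau> \<rho> \<noteq> 0" using T Dne by (simp add: \<tau>_def)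
    then show ?thesis
      unfolding c_def v_def metric_slice_velocity[OF \<open>\<tau> \<rho> \<noteq> 0\<close>]
      unfolding \<xi>'_def \<eta>_def \<eta>'_def \<omega>'_def \<tau>_def \<tau>'_def
      by (intro unit_speed_identity D D_def T A2 N) (simp add: cosh_square_eq)
  qed
  have cont: "continuous_on UNIV \<xi>" "continuous_on UNIV \<eta>"
    using d\<xi> d\<eta> by (auto intro!: continuous_at_imp_continuous_on DERIV_isCont)
  have contD: "continuous_on UNIV D" using D' by (auto intro!: continuous_at_imp_continuous_on DERIV_isCont)
  have cont': "continuous_on UNIV \<xi>'" "continuous_on UNIV \<eta>'" "continuous_on UNIV \<omega>'" "continuous_on UNIV \<tau>'"
    unfolding \<xi>'_def \<eta>'_def \<omega>'_def \<tau>'_def using Dne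
    by (auto intro!: continuous_intros contD)
  have contv: "continuous_on UNIV v"
    unfolding v_def slice_velocity_def
  proof (rule continuous_on_vec_lambda)
    fix j
    show "continuous_on UNIV (\<lambda>\<rho>. if j = e
       then Complex (\<omega>' \<rho> + (\<eta>' \<rho> * (reim e p + \<xi> \<rho> * imsq e p) + \<eta> \<rho> * (\<xi>' \<rho> * imsq e p)) / 2) (\<tau>' \<rho>)
       else Complex (\<xi>' \<rho> * Im (p $ j)) (\<eta>' \<rho> * Im (p $ j)))"
      unfolding Complex_eq by (cases "j = e") (auto intro!: continuous_intros cont cont')
  qed
  define \<gamma> where "\<gamma> s = c (r - r * s)" for s
  have d\<gamma>: "(\<gamma> has_vector_derivative (- r) *\<^sub>R v (r - r * s)) (at s)" for s
  proof -
    have "((\<lambda>s. r - r * s) has_vector_derivative - r) (at s)"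
      by (auto intro!: derivative_eq_intros simp flip: has_real_derivative_iff_has_vector_derivative)
    from vector_diff_chain_at[OF this cv] show ?thesis by (simp add: \<gamma>_def[abs_def] o_def)
  qed
  show ?thesis
  proof (intro exI conjI allI)
    have "\<gamma> C1_differentiable_on {0..1}"
      unfolding C1_differentiable_on_def
      by (intro exI[of _ "\<lambda>s. (- r) *\<^sub>R v (r - r * s)"] conjI ballI d\<gamma> continuous_intros
          continuous_on_compose2[OF contv]) auto
    then show "valid_path \<gamma>" unfolding valid_path_def by (rule C1_differentiable_imp_piecewise)
    show "path_image \<gamma> \<subseteq> CH e"
      using T D by (auto simp: path_image_def \<gamma>_def c_def CH_def tpart_slice_point \<tau>_def)
    have "D r = K\<^sup>2" using AC1 by (simp add: D_def C1_def[symmetric] K)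
    then have "\<xi> r = 0" "\<eta> r = 1" "\<tau> r = tpart e p" "\<omega> r = zpart e p - reim e p / 2"
      using K0 C1 t by (simp_all add: \<xi>_def \<eta>_def \<tau>_def \<omega>_def T_def \<sigma>_def C1_def[symmetric] K_def[symmetric]
          power2_eq_square zpart_eq[OF p])
    then show "pathstart \<gamma> = p" by (simp add: pathstart_def \<gamma>_def c_def slice_point_self)
    show "pathfinish \<gamma> \<in> RH e"
      using T D[of 0] by (simp add: pathfinish_def \<gamma>_def c_def \<eta>_def \<omega>_def \<tau>_def slice_point_in_RH)
    show "speed (CH_metric e) \<gamma> s = r" for s
    proof -
      have "CH_metric e (\<gamma> s) ((- r) *\<^sub>R v (r - r * s)) ((- r) *\<^sub>R v (r - r * s)) = r\<^sup>2"
        unfolding CH_metric_scale by (simp add: unit \<gamma>_def)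
      then show ?thesis
        unfolding speed_def vector_derivative_at[OF d\<gamma>] using r(2) by simp
    qed
  qed
qed


section \<open>Distance and tubes\<close>

lemma riem_infdist_RH_le_0:
  assumes "p \<in> RH e"
  shows "riem_infdist (CH e) (CH_metric e) p (RH e) \<le> 0"
proof -
  have "CH_metric e q 0 0 = 0" for q using CH_metric_scale[of e q 0 0] by simp
  then have "speed (CH_metric e) (linepath p p) = (\<lambda>s. 0)"
    by (simp add: speed_def[abs_def])
  then show ?thesis
    using riem_infdist_RH_le_length[of "linepath p p" e] assms RH_subset_CH[of e] by auto
qed

lemma riem_infdist_RH:
  assumes p: "p \<in> CH e"
  shows "riem_infdist (CH e) (CH_metric e) p (RH e) = arcosh (2 * cosh2_dist e p - 1) / 2"
proof (rule antisym[OF _ arcosh_le_riem_infdist[OF p]])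
  show "riem_infdist (CH e) (CH_metric e) p (RH e) \<le> arcosh (2 * cosh2_dist e p - 1) / 2"
  proof (cases "p \<in> RH e")
    case True
    moreover have "arcosh (2 * cosh2_dist e p - 1) \<ge> 0"
      using cosh2_dist_ge_1[OF p] by (intro arcosh_nonneg_real) simp
    ultimately show ?thesis using riem_infdist_RH_le_0[of p e] by simp
  next
    case False
    define r where "r = arcosh (2 * cosh2_dist e p - 1) / 2"
    have F: "cosh2_dist e p > 1"
      using cosh2_dist_ge_1[OF p] cosh2_dist_eq_1_iff[OF p] False by simp
    have "cosh (2 * r) = 2 * cosh2_dist e p - 1" using F by (simp add: r_def)
    then have "cosh2_dist e p = (cosh r)\<^sup>2" by (simp add: cosh_double_cosh)
    moreover have "r \<ge> 0" using F by (simp add: r_def)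
    ultimately obtain \<gamma> where \<gamma>: "valid_path \<gamma>" "path_image \<gamma> \<subseteq> CH e" "pathstart \<gamma> = p" "pathfinish \<gamma> \<in> RH e"
      and sp: "\<And>s. speed (CH_metric e) \<gamma> s = r"
      using exists_geodesic_to_RH[OF p F] by blast
    from sp have "speed (CH_metric e) \<gamma> = (\<lambda>s. r)" by blast
    then show ?thesis
      using riem_infdist_RH_le_length[OF \<gamma>(1,2) _ \<gamma>(4)] \<gamma>(3) by (simp add: r_def integrable_const_ivl)
  qed
qed

lemma cosh_riem_infdist_RH:
  assumes p: "p \<in> CH e"
  shows "(cosh (riem_infdist (CH e) (CH_metric e) p (RH e)))\<^sup>2 = cosh2_dist e p"
proof -
  have "cosh (2 * riem_infdist (CH e) (CH_metric e) p (RH e)) = 2 * cosh2_dist e p - 1"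
    using cosh2_dist_ge_1[OF p] by (simp add: riem_infdist_RH[OF p])
  then show ?thesis by (simp add: cosh_double_cosh)
qed

lemma riem_infdist_RH_eq_iff:
  assumes "p \<in> CH e" "\<rho> \<ge> 0"
  shows "riem_infdist (CH e) (CH_metric e) p (RH e) = \<rho> \<longleftrightarrow> cosh2_dist e p = (cosh \<rho>)\<^sup>2"
proof
  assume "cosh2_dist e p = (cosh \<rho>)\<^sup>2"
  then have "2 * cosh2_dist e p - 1 = cosh (2 * \<rho>)" by (simp add: cosh_double_cosh)
  then show "riem_infdist (CH e) (CH_metric e) p (RH e) = \<rho>"
    using assms by (simp add: riem_infdist_RH arcosh_cosh_real)
qed (use cosh_riem_infdist_RH[OF assms(1)] in simp)

lemma cosh2_dist_surj:
  assumes "c \<ge> 1"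
  shows "c \<in> cosh2_dist e ` CH e"
proof
  let ?p = "axis e (Complex (sqrt (c - 1)) 1)"
  have 0: "imsq e ?p = 0" by (simp add: imsq_eq_0_iff axis_def)
  show "c = cosh2_dist e ?p"
    using assms by (simp add: cosh2_dist_polynomial 0 reim_eq_0[OF 0])
      (simp add: zpart_def tpart_def axis_def)
  show "?p \<in> CH e" by (simp add: CH_def tpart_def axis_def)
qed

lemma cosh2_dist_regular_iff:
  assumes p: "p \<in> CH e"
  shows "(\<exists>w. frechet_derivative (cosh2_dist e) (at p) w \<noteq> 0) \<longleftrightarrow> cosh2_dist e p > 1"
proof -
  have fd: "frechet_derivative (cosh2_dist e) (at p) = dcosh2 e p"
    using frechet_derivative_at[OF cosh2_dist_has_derivative[OF p]] by simp
  have "\<exists>w. dcosh2 e p w \<noteq> 0" if "cosh2_dist e p > 1"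
  proof
    show "dcosh2 e p (grad_cosh2 e p) \<noteq> 0"
      using that by (simp add: metric_grad_cosh2[OF p, symmetric] norm_grad_cosh2[OF p])
  qed
  moreover have "dcosh2 e p w = 0" if "\<not> cosh2_dist e p > 1" for w
    using that abs_dcosh2_le[OF p, of w] cosh2_dist_ge_1[OF p] by simp
  ultimately show ?thesis unfolding fd by blast
qed

lemma tubes_RH: "tubes (CH e) (CH_metric e) (RH e) = regular_level_sets (CH e) (cosh2_dist e)"
proof (intro equalityI subsetI)
  fix X assume "X \<in> tubes (CH e) (CH_metric e) (RH e)"
  then obtain \<rho> where \<rho>: "\<rho> > 0" "X = {p \<in> CH e. riem_infdist (CH e) (CH_metric e) p (RH e) = \<rho>}"
    unfolding tubes_def by blast
  have "(cosh \<rho>)\<^sup>2 > 1"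
    using \<rho>(1) cosh_real_strict_mono[of 0 \<rho>] by (simp add: one_less_power)
  moreover have "X = {p \<in> CH e. cosh2_dist e p = (cosh \<rho>)\<^sup>2}"
    using \<rho> riem_infdist_RH_eq_iff[where \<rho> = \<rho>] by auto
  ultimately show "X \<in> regular_level_sets (CH e) (cosh2_dist e)"
    unfolding regular_level_sets_def using cosh2_dist_surj[of "(cosh \<rho>)\<^sup>2" e] cosh2_dist_regular_iff[of _ e]
    by fastforce
next
  fix X assume "X \<in> regular_level_sets (CH e) (cosh2_dist e)"
  then obtain c where c: "c \<in> cosh2_dist e ` CH e" "X = {p \<in> CH e. cosh2_dist e p = c}"
    and "\<forall>p\<in>CH e. cosh2_dist e p = c \<longrightarrow> (\<exists>w. frechet_derivative (cosh2_dist e) (at p) w \<noteq> 0)"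
    unfolding regular_level_sets_def by blast
  then have "c > 1" using cosh2_dist_regular_iff[of _ e] by blast
  define \<rho> where "\<rho> = arcosh (sqrt c)"
  have "\<rho> > 0" "c = (cosh \<rho>)\<^sup>2" using \<open>c > 1\<close> by (simp_all add: \<rho>_def)
  then have "X = {p \<in> CH e. riem_infdist (CH e) (CH_metric e) p (RH e) = \<rho>}"
    using c(2) riem_infdist_RH_eq_iff[where \<rho> = \<rho>] by auto
  then show "X \<in> tubes (CH e) (CH_metric e) (RH e)"
    unfolding tubes_def using \<open>\<rho> > 0\<close> by blast
qed

theorem mainTheorem7:
  fixes e :: "'k::finite"
  shows "(\<forall>p\<in>CH e. (cosh (riem_infdist (CH e) (CH_metric e) p (RH e)))\<^sup>2 =
            1 / (tpart e p)\<^sup>2 *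
            ((tpart e p + 1/2 * (norm (Im_vec (vpart e p)))\<^sup>2)\<^sup>2
             + (norm (zpart e p - 1/2 * bracket (Re_vec (vpart e p)) (\<i> *s Im_vec (vpart e p))))\<^sup>2))
       \<and> tubes (CH e) (CH_metric e) (RH e) = regular_level_sets (CH e) (cosh2_dist e)
       \<and> isoparametric (CH e) (CH_metric e) (cosh2_dist e)
       \<and> (\<exists>P. polynomial_of_degree_le 4 P
              \<and> (CARD('k) \<ge> 2 \<longrightarrow> \<not> polynomial_of_degree_le 3 P)
              \<and> (\<forall>p\<in>CH e. cosh2_dist e p = P p / (tpart e p)\<^sup>2))"
proof (intro conjI exI)
  show "\<forall>p\<in>CH e. (cosh (riem_infdist (CH e) (CH_metric e) p (RH e)))\<^sup>2 =
            1 / (tpart e p)\<^sup>2 *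
            ((tpart e p + 1/2 * (norm (Im_vec (vpart e p)))\<^sup>2)\<^sup>2
             + (norm (zpart e p - 1/2 * bracket (Re_vec (vpart e p)) (\<i> *s Im_vec (vpart e p))))\<^sup>2)"
    using cosh_riem_infdist_RH unfolding cosh2_dist_def by blast
  show "tubes (CH e) (CH_metric e) (RH e) = regular_level_sets (CH e) (cosh2_dist e)"
    by (rule tubes_RH)
  show "isoparametric (CH e) (CH_metric e) (cosh2_dist e)"
    by (rule isoparametric_cosh2_dist)
  show "polynomial_of_degree_le 4 (cosh2_numerator e)"
    by (rule cosh2_numerator_quartic)
  show "CARD('k) \<ge> 2 \<longrightarrow> \<not> polynomial_of_degree_le 3 (cosh2_numerator e)"
    using cosh2_numerator_not_cubic by blast
  show "\<forall>p\<in>CH e. cosh2_dist e p = cosh2_numerator e p / (tpart e p)\<^sup>2"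
    by (simp add: cosh2_dist_polynomial cosh2_numerator_def)
qed

end
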